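(* Let $\mathbb K$ be a unital commutative associative ring containing $\frac16$, let $P$ be an SP-graded Kantor pair over $\mathbb K$, let $u\in W_\Delta$ (the Weyl group of the root system $\Delta$ of type $\mathrm{BC}_2$), let $L$ be a $\mathrm{BC}_2$-graded Lie algebra that envelops $P$, and let ${}^uP$ be the SP-graded Kantor pair enveloped by ${}^uL$. Then: (i) $T_{{}^uL}({}^uP)=T_L(P)$; so if $L$ tightly envelops $P$ then ${}^uL$ tightly envelops ${}^uP$. (ii) $u^{-1}(\alpha_1)=\pi(\alpha_1+a\alpha_2)$ and $u^{-1}(\alpha_1+\alpha_2)=\rho(\alpha_1+b\alpha_2)$ for some $\pi=\pm$, $\rho=\pm$, $a,b\in\{0,1\}$, in which case $({}^uP)_0^\sigma=P_a^{\pi\sigma}$ and $({}^uP)_1^\sigma=P_b^{\rho\sigma}$ for $\sigma=\pm$. (iii) If $\sigma=\pm$ and $i,j,k\in\{0,1\}$, the $\sigma$-product on ${}^uP$ restricted to $({}^uP)_i^\sigma\times({}^uP)_j^{-\sigma}\times({}^uP)_k^\sigma$ is given by $[[x,y],z]$ in $L$, which can be expressed in terms of the products in $P$ using (ii) and the formulas, for $x^\tau,y^\tau,z^\tau\in P^\tau$ ($\tau=\pm$): $[[x^\sigma,y^\sigma],z^\sigma]=0$, $[[x^\sigma,y^{-\sigma}],z^\sigma]=\{x^\sigma,y^{-\sigma},z^\sigma\}$, $[[x^{-\sigma},y^\sigma],z^\sigma]=-\{y^\sigma,x^{-\sigma},z^\sigma\}$, $[[x^\sigma,y^\sigma],z^{-\sigma}]=K(x^\sigma,y^\sigma)z^{-\sigma}$.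 (iv) ${}^uP$ does not depend on the choice of the $\mathrm{BC}_2$-graded Lie algebra $L$ enveloping $P$.
   Context: All modules and algebras are over $\mathbb K$; $\sigma=\pm$ (also read as $\pm1$). Kantor pairs. A trilinear pair is a pair $P=(P^-,P^+)$ of modules with trilinear maps ($\sigma$-products) $\{\,,\,,\,\}:P^\sigma\times P^{-\sigma}\times P^\sigma\to P^\sigma$, $\sigma=\pm$. Put $D(x^\sigma,y^{-\sigma})z^\sigma=\{x^\sigma,y^{-\sigma},z^\sigma\}$ and $K(x^\sigma,z^\sigma)y^{-\sigma}=\{x^\sigma,y^{-\sigma},z^\sigma\}-\{z^\sigma,y^{-\sigma},x^\sigma\}$. $P$ is a Kantor pair if for all $x^\sigma,z^\sigma,u^\sigma\in P^\sigma$, $y^{-\sigma},w^{-\sigma}\in P^{-\sigma}$, $\sigma=\pm$: (K1) $[D(x^\sigma,y^{-\sigma}),D(z^\sigma,w^{-\sigma})]=D(D(x^\sigma,y^{-\sigma})z^\sigma,w^{-\sigma})-D(z^\sigma,D(y^{-\sigma},x^\sigma)w^{-\sigma})$; (K2) $K(x^\sigma,z^\sigma)D(w^{-\sigma},u^\sigma)+D(u^\sigma,w^{-\sigma})K(x^\sigma,z^\sigma)=K(K(x^\sigma,z^\sigma)w^{-\sigma},u^\sigma)$. SP-gradings. An SP-grading of $P$ is a pair of decompositions $P^\sigma=P_0^\sigma\oplus P_1^\sigma$ (with $P_i^\sigma=0$ for $i\ne0,1$) such that $\{P_i^\sigma,P_j^{-\sigma},P_k^\sigma\}\subseteq P^\sigma_{i-j+k}$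 for all $i,j,k\in\mathbb Z$, $\sigma=\pm$; $P$ with it is an SP-graded Kantor pair. $\mathrm{BC}_2$-gradings. $\Delta=\{\pm\alpha_1,\pm\alpha_2,\pm(\alpha_1+\alpha_2),\pm2\alpha_1,\pm(2\alpha_1+\alpha_2),\pm(2\alpha_1+2\alpha_2)\}$ is the root system of type $\mathrm{BC}_2$ with base $\{\alpha_1,\alpha_2\}$, where $\alpha_1=\varepsilon_1$, $\alpha_2=-\varepsilon_1+\varepsilon_2$ for an orthonormal basis $\varepsilon_1,\varepsilon_2$ of the Euclidean plane. The root lattice is $\mathbb Z\alpha_1\oplus\mathbb Z\alpha_2$, with $\ell_1\alpha_1+\ell_2\alpha_2$ written $(\ell_1,\ell_2)$. $W_\Delta$ is generated by the reflections $s_1$ ($\alpha_1\mapsto-\alpha_1$, $\alpha_2\mapsto2\alpha_1+\alpha_2$) and $s_2$ ($\alpha_1\mapsto\alpha_1+\alpha_2$, $\alpha_2\mapsto-\alpha_2$). A $\mathrm{BC}_2$-graded Lie algebra is a $\mathbb Z^2$-graded Lie algebra $L=\bigoplus L_{i,j}$ with support in $\Delta\cup\{0\}$. Put $L_{i,*}=\bigoplus_jL_{i,j}$. The SP-graded Kantor pair enveloped by $L$ is $P=(L_{-1,*},L_{1,*})$ with products $\{x^\sigma,y^{-\sigma},z^\sigma\}=[[x^\sigma,y^{-\sigma}],z^\sigma]$ and $P_i^\sigma=L_{\sigma1,\sigma i}$; we then say $L$ envelops $P$. Every SP-graded Kantor pair is enveloped by some $\mathrm{BC}_2$-graded Lie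 algebra. Put $T_L(P)=P^-\oplus P^+\subseteq L$. $L$ tightly envelops $P$ if in addition $T_L(P)$ generates $L$ as an algebra and $Z(L)\cap[T_L(P),T_L(P)]=0$, $Z(L)$ the centre. Weyl images. For $u\in W_\Delta$, ${}^uL$ is the Lie algebra $L$ with the new $\mathrm{BC}_2$-grading $({}^uL)_\alpha=L_{u^{-1}\alpha}$. *)

theory Defs
  imports Complex_Main "HOL-Library.Product_Plus" "HOL-Algebra.Bij" "HOL-Algebra.Generated_Groups"
begin

section \<open>Direct sums of submodules\<close>

definition internal_direct_sum ::
    "('k::comm_ring_1 \<Rightarrow> 'v::ab_group_add \<Rightarrow> 'v) \<Rightarrow> 'v set \<Rightarrow> ('i \<Rightarrow> 'v set) \<Rightarrow> bool" where
  "internal_direct_sum s V C \<longleftrightarrow>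
     module.subspace s V \<and>
     (\<forall>i. module.subspace s (C i) \<and> C i \<subseteq> V) \<and>
     (\<forall>x\<in>V. \<exists>!f. (\<forall>i. f i \<in> C i) \<and> finite {i. f i \<noteq> 0} \<and> x = (\<Sum>i | f i \<noteq> 0. f i))"


section \<open>Kantor pairs and SP-gradings\<close>

text \<open>
  The signs \<open>\<sigma> = \<plusminus>\<close> are the integers \<open>1\<close> and \<open>-1\<close>; sign-indexed fields are junk elsewhere.
  The two modules of a pair are submodules of a common ambient module (any two modules are,
  for instance, submodules of their direct sum); nothing is assumed about their intersection.
\<close>

abbreviation signs :: "int set" where
  "signs \<equiv> {-1, 1}"

record ('k, 'v) sp_pair =
  scal :: "'k \<Rightarrow> 'v \<Rightarrow> 'v"
  part :: "int \<Rightarrow> 'v set"                    \<comment> \<open>\<open>part P \<sigma>\<close> is \<open>P\<^sup>\<sigma>\<close>\<close>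
  pcomp :: "int \<Rightarrow> int \<Rightarrow> 'v set"             \<comment> \<open>\<open>pcomp P \<sigma> i\<close> is \<open>P\<^sub>i\<^sup>\<sigma>\<close>\<close>
  tprod :: "int \<Rightarrow> 'v \<Rightarrow> 'v \<Rightarrow> 'v \<Rightarrow> 'v"     \<comment> \<open>\<open>tprod P \<sigma> x y z\<close> is \<open>{x\<^sup>\<sigma>, y\<^sup>-\<^sup>\<sigma>, z\<^sup>\<sigma>}\<close>\<close>

definition trilinear_pair ::
    "('k::comm_ring_1, 'v::ab_group_add) sp_pair \<Rightarrow> bool" where
  "trilinear_pair P \<longleftrightarrow>
     module (scal P) \<and>
     (\<forall>\<sigma>\<in>signs. module.subspace (scal P) (part P \<sigma>)) \<and>
     (\<forall>\<sigma>\<in>signs. \<forall>x\<in>part P \<sigma>. \<forall>y\<in>part P (-\<sigma>). \<forall>z\<in>part P \<sigma>.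
        tprod P \<sigma> x y z \<in> part P \<sigma> \<and>
        (\<forall>x'\<in>part P \<sigma>. tprod P \<sigma> (x + x') y z = tprod P \<sigma> x y z + tprod P \<sigma> x' y z) \<and>
        (\<forall>y'\<in>part P (-\<sigma>). tprod P \<sigma> x (y + y') z = tprod P \<sigma> x y z + tprod P \<sigma> x y' z) \<and>
        (\<forall>z'\<in>part P \<sigma>. tprod P \<sigma> x y (z + z') = tprod P \<sigma> x y z + tprod P \<sigma> x y z') \<and>
        (\<forall>c. tprod P \<sigma> (scal P c x) y z = scal P c (tprod P \<sigma> x y z) \<and>
             tprod P \<sigma> x (scal P c y) z = scal P c (tprod P \<sigma> x y z) \<and>
             tprod P \<sigma> x y (scal P c z) = scal P c (tprod P \<sigma> x y z)))"

definition Dop :: "('k, 'v) sp_pair \<Rightarrow> int \<Rightarrow> 'v \<Rightarrow> 'v \<Rightarrow> 'v \<Rightarrow> 'v" where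
  "Dop P \<sigma> x y z = tprod P \<sigma> x y z"

definition Kop :: "('k, 'v::ab_group_add) sp_pair \<Rightarrow> int \<Rightarrow> 'v \<Rightarrow> 'v \<Rightarrow> 'v \<Rightarrow> 'v" where
  "Kop P \<sigma> x z y = tprod P \<sigma> x y z - tprod P \<sigma> z y x"

text \<open>
  In \<open>Dop P \<sigma> x y\<close> and \<open>Kop P \<sigma> x z\<close> the sign is that of the first vector argument \<open>x\<close>. The operator
  identities (K1) and (K2) are evaluated at \<open>v\<close> in \<open>P\<^sup>\<sigma>\<close> and \<open>P\<^sup>-\<^sup>\<sigma>\<close>, respectively.
\<close>

definition kantor_pair :: "('k::comm_ring_1, 'v::ab_group_add) sp_pair \<Rightarrow> bool" where
  "kantor_pair P \<longleftrightarrow>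
     trilinear_pair P \<and>
     (\<forall>\<sigma>\<in>signs. \<forall>x\<in>part P \<sigma>. \<forall>z\<in>part P \<sigma>. \<forall>y\<in>part P (-\<sigma>). \<forall>w\<in>part P (-\<sigma>). \<forall>v\<in>part P \<sigma>.
        Dop P \<sigma> x y (Dop P \<sigma> z w v) - Dop P \<sigma> z w (Dop P \<sigma> x y v)
        = Dop P \<sigma> (Dop P \<sigma> x y z) w v - Dop P \<sigma> z (Dop P (-\<sigma>) y x w) v) \<and>
     (\<forall>\<sigma>\<in>signs. \<forall>x\<in>part P \<sigma>. \<forall>z\<in>part P \<sigma>. \<forall>u\<in>part P \<sigma>. \<forall>w\<in>part P (-\<sigma>). \<forall>v\<in>part P (-\<sigma>).
        Kop P \<sigma> x z (Dop P (-\<sigma>) w u v) + Dop P \<sigma> u w (Kop P \<sigma> x z v)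
        = Kop P \<sigma> (Kop P \<sigma> x z w) u v)"

definition sp_graded_kantor_pair ::
    "('k::comm_ring_1, 'v::ab_group_add) sp_pair \<Rightarrow> bool" where
  "sp_graded_kantor_pair P \<longleftrightarrow>
     kantor_pair P \<and>
     (\<forall>\<sigma>\<in>signs. internal_direct_sum (scal P) (part P \<sigma>) (pcomp P \<sigma>) \<and>
        (\<forall>i. i \<notin> {0, 1} \<longrightarrow> pcomp P \<sigma> i = {0}) \<and>
        (\<forall>i j k. \<forall>x\<in>pcomp P \<sigma> i. \<forall>y\<in>pcomp P (-\<sigma>) j. \<forall>z\<in>pcomp P \<sigma> k.
           tprod P \<sigma> x y z \<in> pcomp P \<sigma> (i - j + k)))"

definition sp_isomorphism ::
    "('k::comm_ring_1, 'v::ab_group_add) sp_pair \<Rightarrow> ('k, 'w::ab_group_add) sp_pair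
      \<Rightarrow> (int \<Rightarrow> 'v \<Rightarrow> 'w) \<Rightarrow> bool" where
  "sp_isomorphism P Q \<phi> \<longleftrightarrow>
     (\<forall>\<sigma>\<in>signs.
        bij_betw (\<phi> \<sigma>) (part P \<sigma>) (part Q \<sigma>) \<and>
        (\<forall>x\<in>part P \<sigma>. \<forall>y\<in>part P \<sigma>. \<phi> \<sigma> (x + y) = \<phi> \<sigma> x + \<phi> \<sigma> y) \<and>
        (\<forall>c. \<forall>x\<in>part P \<sigma>. \<phi> \<sigma> (scal P c x) = scal Q c (\<phi> \<sigma> x)) \<and>
        (\<forall>x\<in>part P \<sigma>. \<forall>y\<in>part P (-\<sigma>). \<forall>z\<in>part P \<sigma>.
           \<phi> \<sigma> (tprod P \<sigma> x y z) = tprod Q \<sigma> (\<phi> \<sigma> x) (\<phi> (-\<sigma>) y) (\<phi> \<sigma> z)) \<and>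
        (\<forall>i. \<phi> \<sigma> ` pcomp P \<sigma> i = pcomp Q \<sigma> i))"


section \<open>The root system of type BC2 and its Weyl group\<close>

text \<open>The pair \<open>(m, n)\<close> stands for the element \<open>m \<alpha>\<^sub>1 + n \<alpha>\<^sub>2\<close> of the root lattice.\<close>

type_synonym lattice = "int \<times> int"

definition bc2_roots :: "lattice set" where
  "bc2_roots = (let R = {(1, 0), (0, 1), (1, 1), (2, 0), (2, 1), (2, 2)} in R \<union> uminus ` R)"

definition refl1 :: "lattice \<Rightarrow> lattice" where
  "refl1 = (\<lambda>(m, n). (2 * n - m, n))"

definition refl2 :: "lattice \<Rightarrow> lattice" where
  "refl2 = (\<lambda>(m, n). (m, m - n))"

definition weyl_group :: "(lattice \<Rightarrow> lattice) set" where
  "weyl_group = generate (BijGroup UNIV) {refl1, refl2}"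

lemma refl1_simple_roots: "refl1 (1, 0) = - (1, 0)" "refl1 (0, 1) = (2, 1)"
  and refl2_simple_roots: "refl2 (1, 0) = (1, 1)" "refl2 (0, 1) = - (0, 1)"
  by (simp_all add: refl1_def refl2_def)

lemma refl_carrier: "{refl1, refl2} \<subseteq> carrier (BijGroup UNIV)"
proof -
  have "refl1 \<circ> refl1 = id" "refl2 \<circ> refl2 = id"
    by (auto simp: refl1_def refl2_def fun_eq_iff)
  then have "bij refl1" "bij refl2"
    using o_bij by blast+
  then show ?thesis
    by (simp add: BijGroup_def Bij_def)
qed


section \<open>BC2-graded Lie algebras\<close>

record ('k, 'v) graded_lie =
  lscal :: "'k \<Rightarrow> 'v \<Rightarrow> 'v"
  bracket :: "'v \<Rightarrow> 'v \<Rightarrow> 'v"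
  lcomp :: "lattice \<Rightarrow> 'v set"

definition lie_algebra :: "('k::comm_ring_1, 'v::ab_group_add) graded_lie \<Rightarrow> bool" where
  "lie_algebra L \<longleftrightarrow>
     module (lscal L) \<and>
     (\<forall>x. module_hom (lscal L) (lscal L) (\<lambda>y. bracket L x y)) \<and>
     (\<forall>y. module_hom (lscal L) (lscal L) (\<lambda>x. bracket L x y)) \<and>
     (\<forall>x. bracket L x x = 0) \<and>
     (\<forall>x y z. bracket L x (bracket L y z) + bracket L y (bracket L z x)
              + bracket L z (bracket L x y) = 0)"

definition bc2_graded_lie :: "('k::comm_ring_1, 'v::ab_group_add) graded_lie \<Rightarrow> bool" where
  "bc2_graded_lie L \<longleftrightarrow>
     lie_algebra L \<and>
     internal_direct_sum (lscal L) UNIV (lcomp L) \<and>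
     (\<forall>\<alpha> \<beta>. \<forall>x\<in>lcomp L \<alpha>. \<forall>y\<in>lcomp L \<beta>. bracket L x y \<in> lcomp L (\<alpha> + \<beta>)) \<and>
     (\<forall>\<alpha>. \<alpha> \<notin> bc2_roots \<union> {0} \<longrightarrow> lcomp L \<alpha> = {0})"

definition lrow :: "('k::comm_ring_1, 'v::ab_group_add) graded_lie \<Rightarrow> int \<Rightarrow> 'v set" where
  "lrow L i = module.span (lscal L) (\<Union>j. lcomp L (i, j))"

definition enveloped_pair ::
    "('k::comm_ring_1, 'v::ab_group_add) graded_lie \<Rightarrow> ('k, 'v) sp_pair" where
  "enveloped_pair L =
     \<lparr> scal = lscal L,
       part = lrow L,
       pcomp = (\<lambda>\<sigma> i. lcomp L (\<sigma>, \<sigma> * i)),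
       tprod = (\<lambda>\<sigma> x y z. bracket L (bracket L x y) z) \<rparr>"

text \<open>
  \<open>L\<close> envelops \<open>P\<close> if \<open>P\<close> is the pair \<open>enveloped_pair L\<close>. The identification of \<open>P\<close> with that pair is
  recorded as a family \<open>\<iota>\<close> of maps, so that one pair can be enveloped by Lie algebras on
  different types. Literal equality is the case where every \<open>\<iota> \<sigma>\<close> is the identity.
\<close>

definition envelops ::
    "('k::comm_ring_1, 'l::ab_group_add) graded_lie \<Rightarrow> (int \<Rightarrow> 'p \<Rightarrow> 'l)
      \<Rightarrow> ('k, 'p::ab_group_add) sp_pair \<Rightarrow> bool" where
  "envelops L \<iota> P \<longleftrightarrow>
     bc2_graded_lie L \<and> sp_graded_kantor_pair P \<and> sp_isomorphism P (enveloped_pair L) \<iota>"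

definition T_sub :: "(int \<Rightarrow> 'p \<Rightarrow> 'l) \<Rightarrow> ('k, 'p) sp_pair \<Rightarrow> 'l::ab_group_add set" where
  "T_sub \<iota> P = {\<iota> (-1) x + \<iota> 1 y | x y. x \<in> part P (-1) \<and> y \<in> part P 1}"

definition lie_subalgebra ::
    "('k::comm_ring_1, 'l::ab_group_add) graded_lie \<Rightarrow> 'l set \<Rightarrow> bool" where
  "lie_subalgebra L S \<longleftrightarrow>
     module.subspace (lscal L) S \<and> (\<forall>x\<in>S. \<forall>y\<in>S. bracket L x y \<in> S)"

definition lie_center :: "('k, 'l::ab_group_add) graded_lie \<Rightarrow> 'l set" where
  "lie_center L = {z. \<forall>x. bracket L z x = 0}"

definition bracket_span ::
    "('k::comm_ring_1, 'l::ab_group_add) graded_lie \<Rightarrow> 'l set \<Rightarrow> 'l set \<Rightarrow> 'l set" where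
  "bracket_span L S T = module.span (lscal L) {bracket L x y | x y. x \<in> S \<and> y \<in> T}"

definition tightly_envelops ::
    "('k::comm_ring_1, 'l::ab_group_add) graded_lie \<Rightarrow> (int \<Rightarrow> 'p \<Rightarrow> 'l)
      \<Rightarrow> ('k, 'p::ab_group_add) sp_pair \<Rightarrow> bool" where
  "tightly_envelops L \<iota> P \<longleftrightarrow>
     envelops L \<iota> P \<and>
     lie_subalgebra L hull T_sub \<iota> P = UNIV \<and>
     lie_center L \<inter> bracket_span L (T_sub \<iota> P) (T_sub \<iota> P) = {0}"


section \<open>Weyl images\<close>

definition weyl_lie ::
    "(lattice \<Rightarrow> lattice) \<Rightarrow> ('k, 'l) graded_lie \<Rightarrow> ('k, 'l) graded_lie" where
  "weyl_lie u L = L\<lparr> lcomp := (\<lambda>\<alpha>. lcomp L (inv_into UNIV u \<alpha>)) \<rparr>"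

definition weyl_pair ::
    "(lattice \<Rightarrow> lattice) \<Rightarrow> ('k::comm_ring_1, 'l::ab_group_add) graded_lie \<Rightarrow> ('k, 'l) sp_pair" where
  "weyl_pair u L = enveloped_pair (weyl_lie u L)"

text \<open>\<open>u\<^sup>-\<^sup>1(\<alpha>\<^sub>1) = \<pi>(\<alpha>\<^sub>1 + a \<alpha>\<^sub>2)\<close> and \<open>u\<^sup>-\<^sup>1(\<alpha>\<^sub>1 + \<alpha>\<^sub>2) = \<rho>(\<alpha>\<^sub>1 + b \<alpha>\<^sub>2)\<close>\<close>

definition weyl_data ::
    "(lattice \<Rightarrow> lattice) \<Rightarrow> int \<Rightarrow> int \<Rightarrow> int \<Rightarrow> int \<Rightarrow> bool" where
  "weyl_data u \<pi> \<rho> a b \<longleftrightarrow>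
     \<pi> \<in> signs \<and> \<rho> \<in> signs \<and> a \<in> {0, 1} \<and> b \<in> {0, 1} \<and>
     inv_into UNIV u (1, 0) = (\<pi>, \<pi> * a) \<and>
     inv_into UNIV u (1, 1) = (\<rho>, \<rho> * b)"

text \<open>
  The double bracket \<open>[[x, y], z]\<close> of elements of \<open>P\<close> of signs \<open>\<tau>\<^sub>1\<close>, \<open>\<tau>\<^sub>2\<close>, \<open>\<tau>\<^sub>3\<close>, written with the products
  of \<open>P\<close>; the last case is \<open>\<tau>\<^sub>1 = - \<tau>\<^sub>2\<close> and \<open>\<tau>\<^sub>3 = \<tau>\<^sub>2\<close>.
\<close>

definition double_bracket_in ::
    "(int \<Rightarrow> 'p \<Rightarrow> 'l) \<Rightarrow> ('k, 'p::ab_group_add) sp_pair \<Rightarrow> int \<Rightarrow> int \<Rightarrow> int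
      \<Rightarrow> 'p \<Rightarrow> 'p \<Rightarrow> 'p \<Rightarrow> 'l::ab_group_add" where
  "double_bracket_in \<iota> P \<tau>\<^sub>1 \<tau>\<^sub>2 \<tau>\<^sub>3 x y z =
     (if \<tau>\<^sub>1 = \<tau>\<^sub>2 then (if \<tau>\<^sub>3 = \<tau>\<^sub>1 then 0 else \<iota> \<tau>\<^sub>1 (Kop P \<tau>\<^sub>1 x y z))
      else (if \<tau>\<^sub>3 = \<tau>\<^sub>1 then \<iota> \<tau>\<^sub>1 (tprod P \<tau>\<^sub>1 x y z) else - \<iota> \<tau>\<^sub>2 (tprod P \<tau>\<^sub>2 y x z)))"

end

theory Submission
  imports Defs
begin

text \<open>
  \<open>W\<^sub>\<Delta>\<close> permutes the short roots \<open>\<plusminus>\<alpha>\<^sub>1\<close>, \<open>\<plusminus>(\<alpha>\<^sub>1 + \<alpha>\<^sub>2)\<close>, and \<open>T\<^sub>L(P)\<close> is the sum of the short root spaces, so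
  it is the same for \<open>L\<close> and \<open>\<^sup>uL\<close>. It is closed under \<open>[[x, y], z]\<close>, and this operation is determined on it
  by the products of \<open>P\<close>. Hence for two Lie algebras \<open>L\<close>, \<open>L'\<close> enveloping \<open>P\<close> the identification of \<open>T\<^sub>L(P)\<close>
  with \<open>T\<^sub>L\<^sub>'(P)\<close> through \<open>P\<close> preserves double brackets, and restricts to an isomorphism of the two
  Weyl images for every \<open>u\<close>.
\<close>

text \<open>\<open>L\<close> is not determined by P: an abelian summand placed in degree 0, for
  instance, leaves P unchanged. So no isomorphism of \<open>L\<close> with \<open>L'\<close> can be
  expected, and the comparison has to stay inside T_L(P). The regrading by u mixes signs: row
  \<sigma> of the new grading may consist of one component of P^+ and one of P^-. Hence the separate
  maps \<open>\<iota> (-1)\<close> and \<open>\<iota> 1\<close> are glued to one map on the sum of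
  both rows, and the double brackets of all eight sign patterns have to be read off from P. This is
  possible because the first coordinate of a root is the sum of its \<epsilon>-coordinates and runs
  from -2 to 2: three elements of equal sign would have their double bracket in degree 3 or -3,
  where \<open>L\<close> vanishes, while antisymmetry and the Jacobi identity reduce the other
  patterns to a product or to K. Since the two Weyl images may live on different types, their
  equality in (iv) becomes an isomorphism that is compatible with \<iota> and \<iota>'.\<close>

section \<open>The Weyl group as signed permutations\<close>

text \<open>Every \<open>u \<in> W\<^sub>\<Delta>\<close> permutes \<open>\<plusminus>\<epsilon>\<^sub>1 = \<plusminus>(1, 0)\<close> and \<open>\<plusminus>\<epsilon>\<^sub>2 = \<plusminus>(1, 1)\<close>; in this basis
  \<open>(m, n) = (m - n) \<epsilon>\<^sub>1 + n \<epsilon>\<^sub>2\<close>.\<close>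

definition signed_perm :: "int \<Rightarrow> int \<Rightarrow> int \<Rightarrow> lattice \<Rightarrow> lattice" where
  "signed_perm \<pi> \<rho> a = (\<lambda>(m, n). ((m - n) * \<pi> + n * \<rho>, (m - n) * (\<pi> * a) + n * (\<rho> * (1 - a))))"

definition signed_perms :: "(lattice \<Rightarrow> lattice) set" where
  "signed_perms = {signed_perm \<pi> \<rho> a | \<pi> \<rho> a. \<pi> \<in> signs \<and> \<rho> \<in> signs \<and> a \<in> {0, 1}}"

lemma signed_permsI:
  "\<pi> \<in> signs \<Longrightarrow> \<rho> \<in> signs \<Longrightarrow> a \<in> {0, 1} \<Longrightarrow> f = signed_perm \<pi> \<rho> a \<Longrightarrow> f \<in> signed_perms"
  unfolding signed_perms_def by blast

lemma signed_perms_comp: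
  assumes "f \<in> signed_perms" "g \<in> signed_perms"
  shows "f \<circ> g \<in> signed_perms"
proof -
  obtain p r a p' r' a' where f: "f = signed_perm p r a" "g = signed_perm p' r' a'"
    and s: "p \<in> signs" "r \<in> signs" "a \<in> {0, 1}" "p' \<in> signs" "r' \<in> signs" "a' \<in> {0, 1}"
    using assms unfolding signed_perms_def by blast
  have c: "f \<circ> g = signed_perm (p' * (if a' = 0 then p else r)) (r' * (if a' = 0 then r else p))
      (if a = a' then 0 else 1)"
    using s unfolding f signed_perm_def
    by (elim insertE emptyE; simp add: fun_eq_iff algebra_simps)
  show ?thesis
    by (rule signed_permsI[OF _ _ _ c]) (use s in \<open>elim insertE emptyE; simp\<close>)+
qed

lemma refl_signed_perms: "{refl1, refl2} \<subseteq> signed_perms"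
proof -
  have "refl1 = signed_perm (-1) 1 0" "refl2 = signed_perm 1 1 1"
    by (auto simp: refl1_def refl2_def signed_perm_def fun_eq_iff)
  then show ?thesis
    by (auto intro: signed_permsI[of "-1" 1 0] signed_permsI[of 1 1 1])
qed

text \<open>The set \<open>generate\<close> takes inverses of generators only, so these involutions
  are the only inverses met in an induction over \<open>weyl_group\<close>.\<close>

lemma inv_refl:
  assumes "h \<in> {refl1, refl2}"
  shows "inv_into UNIV h = h"
proof -
  have "refl1 \<circ> refl1 = id" "refl2 \<circ> refl2 = id"
    by (auto simp: refl1_def refl2_def fun_eq_iff)
  with assms show ?thesis
    using inv_unique_comp by blast
qed

interpretation lattice_bij: group "BijGroup (UNIV :: lattice set)"
  by (rule group_BijGroup)

lemma weyl_group_bij: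
  assumes "u \<in> weyl_group"
  shows "bij u"
  using lattice_bij.generate_in_carrier[OF refl_carrier, of u] assms
  by (simp add: weyl_group_def BijGroup_def Bij_def)

lemma weyl_group_inv:
  assumes "u \<in> weyl_group"
  shows "inv_into UNIV u \<in> weyl_group"
proof -
  have "u \<in> Bij UNIV"
    using weyl_group_bij[OF assms] by (simp add: Bij_def)
  then show ?thesis
    using lattice_bij.generate_m_inv_closed[OF refl_carrier, of u] assms
    by (simp add: weyl_group_def inv_BijGroup restrict_UNIV)
qed

lemma weyl_group_signed_perm: "u \<in> weyl_group \<Longrightarrow> u \<in> signed_perms"
  unfolding weyl_group_def
proof (induction rule: generate.induct)
  case one
  have "(\<lambda>x. x) = signed_perm 1 1 0"
    by (auto simp: signed_perm_def fun_eq_iff)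
  then have "(\<lambda>x. x) \<in> signed_perms"
    by (intro signed_permsI[of 1 1 0]) auto
  then show ?case
    by (simp add: BijGroup_def restrict_UNIV)
next
  case (incl h)
  then show ?case
    using refl_signed_perms by blast
next
  case (inv h)
  then have "h \<in> Bij UNIV"
    using refl_carrier by (auto simp: BijGroup_def)
  then show ?case
    using inv refl_signed_perms inv_refl[OF inv] by (auto simp: inv_BijGroup restrict_UNIV)
next
  case (eng h1 h2)
  \<comment> \<open>Multiplication in \<open>BijGroup\<close> is composition only on bijections, so
    both factors must first be known to be bijective.\<close>
  then have "h1 \<in> Bij UNIV" "h2 \<in> Bij UNIV"
    using weyl_group_bij by (simp_all add: weyl_group_def Bij_def)
  then have "h1 \<otimes>\<^bsub>BijGroup UNIV\<^esub> h2 = h1 \<circ> h2"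
    by (simp add: BijGroup_def compose_def comp_def restrict_UNIV)
  then show ?case
    using eng signed_perms_comp by metis
qed

lemma signed_perms_add: "v \<in> signed_perms \<Longrightarrow> v (\<alpha> + \<beta>) = v \<alpha> + v \<beta>"
  by (cases \<alpha>; cases \<beta>) (auto simp: signed_perms_def signed_perm_def algebra_simps)

lemma bc2_roots_zero:
  "bc2_roots \<union> {0} = {(0, 0), (1, 0), (0, 1), (1, 1), (2, 0), (2, 1), (2, 2),
     (-1, 0), (0, -1), (-1, -1), (-2, 0), (-2, -1), (-2, -2)}"
  by (simp add: bc2_roots_def Let_def zero_prod_def insert_commute)

text \<open>In the \<epsilon>-basis the roots are the vectors obtained from \<epsilon>1, 2
  \<epsilon>1 and \<epsilon>1 + \<epsilon>2 by permuting coordinates and changing signs. The proof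
  checks all cases.\<close>

lemma signed_perms_roots:
  assumes "v \<in> signed_perms" "\<alpha> \<in> bc2_roots \<union> {0}"
  shows "v \<alpha> \<in> bc2_roots \<union> {0}"
proof -
  obtain p r a where s: "p \<in> signs" "r \<in> signs" "a \<in> {0, 1}" and v: "v = signed_perm p r a"
    using assms(1) unfolding signed_perms_def by blast
  show ?thesis
    using s assms(2) unfolding v bc2_roots_zero
    by (elim insertE emptyE; simp add: signed_perm_def)
qed

definition short_roots :: "lattice set" where
  "short_roots = {(1, 0), (1, 1), (-1, 0), (-1, -1)}"

lemma signed_perms_short_roots:
  assumes "v \<in> signed_perms"
  shows "v ` short_roots = short_roots"
proof -
  obtain p r a where s: "p \<in> signs" "r \<in> signs" "a \<in> {0, 1}" and v: "v = signed_perm p r a"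
    using assms unfolding signed_perms_def by blast
  show ?thesis
    using s unfolding v short_roots_def
    by (elim insertE emptyE; simp add: signed_perm_def; blast)
qed

lemma weyl_data_exists:
  assumes "u \<in> weyl_group"
  shows "\<exists>\<pi> \<rho> a b. weyl_data u \<pi> \<rho> a b"
proof -
  obtain p r a where *: "p \<in> signs" "r \<in> signs" "a \<in> {0, 1}" "inv_into UNIV u = signed_perm p r a"
    using weyl_group_signed_perm[OF weyl_group_inv[OF assms]] unfolding signed_perms_def by blast
  \<comment> \<open>The images of \<epsilon>1 and \<epsilon>2 lie on different axes, which forces b
    = 1 - a.\<close>
  then have "weyl_data u p r a (1 - a)"
    unfolding weyl_data_def by (elim insertE emptyE; simp add: signed_perm_def)
  then show ?thesis by blast
qed

text \<open>Linear extension of the two values in \<open>weyl_data\<close>. With \<tau> = \<pi> *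
  \<sigma> the result has the form (\<tau>, \<tau> * a), which is the degree of the component of
  sign \<tau> and index a.\<close>

lemma weyl_data_inv:
  assumes "u \<in> weyl_group" "weyl_data u \<pi> \<rho> a b"
  shows "inv_into UNIV u (\<sigma>, 0) = (\<pi> * \<sigma>, \<pi> * \<sigma> * a)"
    and "inv_into UNIV u (\<sigma>, \<sigma>) = (\<rho> * \<sigma>, \<rho> * \<sigma> * b)"
proof -
  obtain p r c where v: "inv_into UNIV u = signed_perm p r c"
    using weyl_group_signed_perm[OF weyl_group_inv[OF assms(1)]] unfolding signed_perms_def by blast
  have e: "p = \<pi>" "p * c = \<pi> * a" "r = \<rho>" "r * (1 - c) = \<rho> * b"
    using assms(2) unfolding weyl_data_def v signed_perm_def by auto
  have "inv_into UNIV u (\<sigma>, 0) = (\<sigma> * p, \<sigma> * (p * c))"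
       "inv_into UNIV u (\<sigma>, \<sigma>) = (\<sigma> * r, \<sigma> * (r * (1 - c)))"
    unfolding v signed_perm_def by simp_all
  then show "inv_into UNIV u (\<sigma>, 0) = (\<pi> * \<sigma>, \<pi> * \<sigma> * a)"
       "inv_into UNIV u (\<sigma>, \<sigma>) = (\<rho> * \<sigma>, \<rho> * \<sigma> * b)"
    unfolding e(2) e(4) by (simp_all add: e(1) e(3) ac_simps)
qed


section \<open>Direct sums\<close>

text \<open>Supplies the direct sum axiom for \<open>weyl_lie u L\<close>, whose components are
  those of \<open>L\<close> with permuted indices.\<close>

lemma internal_direct_sum_reindex:
  assumes C: "internal_direct_sum s V C" and h: "bij h"
  shows "internal_direct_sum s V (\<lambda>i. C (h i))"
proof -
  have sum_h: "(\<Sum>i | f (h i) \<noteq> 0. f (h i)) = (\<Sum>i | f i \<noteq> 0. f i)"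
    and fin_h: "finite {i. f (h i) \<noteq> 0} \<longleftrightarrow> finite {i. f i \<noteq> 0}" for f :: "_ \<Rightarrow> 'b"
  proof -
    have bb: "bij_betw h {i. f (h i) \<noteq> 0} {i. f i \<noteq> 0}"
    proof (rule bij_betw_imageI)
      show "inj_on h {i. f (h i) \<noteq> 0}"
        by (rule inj_on_subset[OF bij_is_inj[OF h] subset_UNIV])
      show "h ` {i. f (h i) \<noteq> 0} = {i. f i \<noteq> 0}"
      proof
        show "{i. f i \<noteq> 0} \<subseteq> h ` {i. f (h i) \<noteq> 0}"
        proof
          fix j assume j: "j \<in> {i. f i \<noteq> 0}"
          obtain i where "j = h i"
            using surjD[OF bij_is_surj[OF h]] by blast
          then show "j \<in> h ` {i. f (h i) \<noteq> 0}"
            using j by simp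
        qed
      qed auto
    qed
    show "(\<Sum>i | f (h i) \<noteq> 0. f (h i)) = (\<Sum>i | f i \<noteq> 0. f i)"
      by (rule sum.reindex_bij_betw[OF bb])
    show "finite {i. f (h i) \<noteq> 0} \<longleftrightarrow> finite {i. f i \<noteq> 0}"
      by (rule bij_betw_finite[OF bb])
  qed
  have "\<exists>!g. (\<forall>i. g i \<in> C (h i)) \<and> finite {i. g i \<noteq> 0} \<and> x = (\<Sum>i | g i \<noteq> 0. g i)"
    if "x \<in> V" for x
  proof -
    have ex1: "\<exists>!f. (\<forall>i. f i \<in> C i) \<and> finite {i. f i \<noteq> 0} \<and> x = (\<Sum>i | f i \<noteq> 0. f i)"
      using C that unfolding internal_direct_sum_def by simp
    have all_h: "(\<forall>i. f (h i) \<in> C (h i)) \<longleftrightarrow> (\<forall>i. f i \<in> C i)" for f :: "_ \<Rightarrow> 'b"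
    proof
      assume *: "\<forall>i. f (h i) \<in> C (h i)"
      show "\<forall>i. f i \<in> C i"
      proof
        fix j
        obtain i where "j = h i"
          using surjD[OF bij_is_surj[OF h]] by blast
        then show "f j \<in> C j"
          using * by simp
      qed
    qed simp
    have key: "(\<forall>i. f (h i) \<in> C (h i)) \<and> finite {i. f (h i) \<noteq> 0} \<and> x = (\<Sum>i | f (h i) \<noteq> 0. f (h i))
        \<longleftrightarrow> (\<forall>i. f i \<in> C i) \<and> finite {i. f i \<noteq> 0} \<and> x = (\<Sum>i | f i \<noteq> 0. f i)" for f
      by (simp only: sum_h[of f] fin_h[of f] all_h[of f])
    obtain f where f: "(\<forall>i. f i \<in> C i) \<and> finite {i. f i \<noteq> 0} \<and> x = (\<Sum>i | f i \<noteq> 0. f i)"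
      using ex1 by blast
    show ?thesis
    proof (rule ex1I[of _ "\<lambda>i. f (h i)"])
      show "(\<forall>i. f (h i) \<in> C (h i)) \<and> finite {i. f (h i) \<noteq> 0} \<and> x = (\<Sum>i | f (h i) \<noteq> 0. f (h i))"
        using f key by blast
    next
      fix g assume g: "(\<forall>i. g i \<in> C (h i)) \<and> finite {i. g i \<noteq> 0} \<and> x = (\<Sum>i | g i \<noteq> 0. g i)"
      define g' where "g' = g \<circ> inv_into UNIV h"
      have gh: "g = (\<lambda>i. g' (h i))"
        using bij_is_inj[OF h] by (auto simp: g'_def)
      have "(\<forall>i. g' i \<in> C i) \<and> finite {i. g' i \<noteq> 0} \<and> x = (\<Sum>i | g' i \<noteq> 0. g' i)"
        using g unfolding gh key[of g'] .
      then have "g' = f"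
        using ex1 f by blast
      then show "g = (\<lambda>i. f (h i))"
        using gh by simp
    qed
  qed
  moreover have "module.subspace s V" "module.subspace s (C (h i)) \<and> C (h i) \<subseteq> V" for i
    using C unfolding internal_direct_sum_def by simp_all
  ultimately show ?thesis
    unfolding internal_direct_sum_def by simp
qed

text \<open>The index runs through all integers, but a family in C is supported in {0, 1}. A
  representation is thus a pair, and two representations of the same element differ by an element of
  \<open>C 0 \<inter> C 1\<close>.\<close>

lemma internal_direct_sum_two:
  fixes C :: "int \<Rightarrow> 'v::ab_group_add set"
  assumes s: "module s"
    and C0: "module.subspace s (C 0)" and C1: "module.subspace s (C 1)"
    and C: "\<And>i. i \<notin> {0, 1} \<Longrightarrow> C i = {0}"
    and V: "V = {x + y | x y. x \<in> C 0 \<and> y \<in> C 1}" and disj: "C 0 \<inter> C 1 = {0}"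
  shows "internal_direct_sum s V C"
proof -
  interpret module s by (rule s)
  have sum2: "finite {i. f i \<noteq> 0} \<and> (\<Sum>i | f i \<noteq> 0. f i) = f 0 + f 1"
    if "\<forall>i. f i \<in> C i" for f
  proof -
    have sub: "{i. f i \<noteq> 0} \<subseteq> {0, 1}"
      using that C by fastforce
    then have "(\<Sum>i | f i \<noteq> 0. f i) = (\<Sum>i\<in>{0, 1}. f i)"
      by (intro sum.mono_neutral_left) auto
    then show ?thesis
      using sub finite_subset by auto
  qed
  have V_span: "V = span (C 0 \<union> C 1)"
    using span_Un[of "C 0" "C 1"] C0 C1 V by (simp add: span_eq_iff[THEN iffD2])
  have Csub: "subspace (C i) \<and> C i \<subseteq> V" for i
  proof (cases "i \<in> {0, 1}")
    case True
    then show ?thesis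
      using C0 C1 V_span span_superset[of "C 0 \<union> C 1"] by auto
  next
    case False
    then show ?thesis
      using C V_span span_zero by simp
  qed
  have "\<exists>!f. (\<forall>i. f i \<in> C i) \<and> finite {i. f i \<noteq> 0} \<and> x = (\<Sum>i | f i \<noteq> 0. f i)"
    if x: "x \<in> V" for x
  proof -
    obtain y z where yz: "x = y + z" "y \<in> C 0" "z \<in> C 1"
      using x V by blast
    define f where "f = (\<lambda>i::int. if i = 0 then y else if i = 1 then z else 0)"
    have f01: "f 0 = y" "f 1 = z" and f: "\<forall>i. f i \<in> C i"
      using yz C by (auto simp: f_def)
    show ?thesis
    proof (rule ex1I[of _ f])
      show "(\<forall>i. f i \<in> C i) \<and> finite {i. f i \<noteq> 0} \<and> x = (\<Sum>i | f i \<noteq> 0. f i)"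
        using sum2[OF f] f f01 yz(1) by metis
    next
      fix g assume g: "(\<forall>i. g i \<in> C i) \<and> finite {i. g i \<noteq> 0} \<and> x = (\<Sum>i | g i \<noteq> 0. g i)"
      then have "g 0 + g 1 = y + z"
        using sum2[of g] yz(1) by metis
      then have e: "g 0 - y = z - g 1"
        by (simp add: algebra_simps)
      have "g 0 - y \<in> C 0" "z - g 1 \<in> C 1"
        using g yz subspace_diff C0 C1 by blast+
      then have "g 0 - y \<in> C 0 \<inter> C 1"
        using e by simp
      then have "g 0 - y = 0"
        using disj by blast
      then have "g 0 = y" "g 1 = z"
        using e by simp_all
      moreover have "g i = 0" if "i \<notin> {0, 1}" for i
        using g C[OF that] by blast
      ultimately show "g = f"
        by (auto simp: f_def)
    qed
  qed
  then show ?thesis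
    using Csub V_span unfolding internal_direct_sum_def by simp
qed

text \<open>An element of the span over A has a representation supported in A. By uniqueness, a
  common element of both spans has a single representation, supported in A and in B, hence
  nowhere.\<close>

lemma internal_direct_sum_span_disjoint:
  assumes s: "module s" and C: "internal_direct_sum s UNIV C" and AB: "A \<inter> B = {}"
  shows "module.span s (\<Union>i\<in>A. C i) \<inter> module.span s (\<Union>i\<in>B. C i) = {0}"
proof -
  interpret module s by (rule s)
  have sub: "subspace (C i)" for i
    using C unfolding internal_direct_sum_def by blast
  have rep: "\<exists>f. (\<forall>i. f i \<in> C i) \<and> finite {i. f i \<noteq> 0} \<and> x = (\<Sum>i | f i \<noteq> 0. f i) \<and> {i. f i \<noteq> 0} \<subseteq> A"
    if "x \<in> span (\<Union>i\<in>A. C i)" for x A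
  proof -
    \<comment> \<open>The induction carries a finite set F around the support instead of the support
      itself, since adding a vector to one entry may cancel it.\<close>
    have "\<exists>f F. finite F \<and> F \<subseteq> A \<and> (\<forall>i. f i \<in> C i) \<and> (\<forall>i. i \<notin> F \<longrightarrow> f i = 0) \<and> x = sum f F"
      using that
    proof (induction rule: span_induct_alt)
      case base
      show ?case
        using subspace_0[OF sub] by (intro exI[of _ "\<lambda>_. 0"] exI[of _ "{}"]) auto
    next
      case (step c x y)
      obtain i where i: "i \<in> A" "x \<in> C i"
        using step by blast
      obtain f F where f: "finite F" "F \<subseteq> A" "\<forall>i. f i \<in> C i" "\<forall>i. i \<notin> F \<longrightarrow> f i = 0" "y = sum f F"
        using step by blast
      let ?f = "f(i := s c x + f i)"
      \<comment> \<open>If i lies outside F then f i = 0, so the splitting holds in both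
        cases.\<close>
      have e: "sum f F = f i + sum f (F - {i})"
        using f by (cases "i \<in> F") (auto simp: sum.remove)
      have "sum ?f (insert i F) = ?f i + sum ?f (F - {i})"
        using f by (simp add: sum.insert_remove)
      also have "sum ?f (F - {i}) = sum f (F - {i})"
        by (rule sum.cong) auto
      finally have "s c x + y = sum ?f (insert i F)"
        using e f by (simp add: algebra_simps)
      moreover have "\<forall>j. ?f j \<in> C j"
        using f i sub subspace_add subspace_scale by (simp add: fun_upd_def)
      ultimately show ?case
        using f i by (intro exI[of _ ?f] exI[of _ "insert i F"]) auto
    qed
    then obtain f F where f: "finite F" "F \<subseteq> A" "\<forall>i. f i \<in> C i" "\<forall>i. i \<notin> F \<longrightarrow> f i = 0" "x = sum f F"
      by blast
    have supp: "{i. f i \<noteq> 0} \<subseteq> F"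
      using f by blast
    have "(\<Sum>i | f i \<noteq> 0. f i) = sum f F"
      by (rule sum.mono_neutral_left) (use f supp in auto)
    then show ?thesis
      using f supp finite_subset by (intro exI[of _ f]) auto
  qed
  have "x = 0" if x: "x \<in> span (\<Union>i\<in>A. C i)" "x \<in> span (\<Union>i\<in>B. C i)" for x
  proof -
    obtain f where f: "(\<forall>i. f i \<in> C i) \<and> finite {i. f i \<noteq> 0} \<and> x = (\<Sum>i | f i \<noteq> 0. f i)"
        "{i. f i \<noteq> 0} \<subseteq> A"
      using rep[OF x(1)] by blast
    obtain g where g: "(\<forall>i. g i \<in> C i) \<and> finite {i. g i \<noteq> 0} \<and> x = (\<Sum>i | g i \<noteq> 0. g i)"
        "{i. g i \<noteq> 0} \<subseteq> B"
      using rep[OF x(2)] by blast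
    have "f = g"
      using C f(1) g(1) unfolding internal_direct_sum_def by blast
    then have "{i. f i \<noteq> 0} = {}"
      using f g AB by blast
    with f(1) show ?thesis
      by (metis sum.empty)
  qed
  then show ?thesis
    using span_zero by auto
qed

section \<open>Pairs enveloped by BC2-graded Lie algebras\<close>

locale bc2_lie =
  fixes L :: "('k::comm_ring_1, 'l::ab_group_add) graded_lie"
  assumes graded: "bc2_graded_lie L"
begin

sublocale module "lscal L"
  using graded unfolding bc2_graded_lie_def lie_algebra_def by blast

abbreviation lbr :: "'l \<Rightarrow> 'l \<Rightarrow> 'l" where
  "lbr \<equiv> bracket L"

lemma lbr_hom:
  "module_hom (lscal L) (lscal L) (lbr x)" "module_hom (lscal L) (lscal L) (\<lambda>x. lbr x y)"
  using graded unfolding bc2_graded_lie_def lie_algebra_def by simp_all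

lemmas lbr_right = module_hom.add[OF lbr_hom(1)] module_hom.scale[OF lbr_hom(1)]
  module_hom.diff[OF lbr_hom(1)] module_hom.neg[OF lbr_hom(1)] module_hom.zero[OF lbr_hom(1)]

lemmas lbr_left = module_hom.add[OF lbr_hom(2)] module_hom.scale[OF lbr_hom(2)]
  module_hom.diff[OF lbr_hom(2)] module_hom.neg[OF lbr_hom(2)] module_hom.zero[OF lbr_hom(2)]

lemma lbr_self: "lbr x x = 0"
  using graded unfolding bc2_graded_lie_def lie_algebra_def by simp

lemma lbr_anti: "lbr y x = - lbr x y"
proof -
  have "lbr (x + y) (x + y) = lbr x y + lbr y x"
    using lbr_self[of x] lbr_self[of y] by (simp add: lbr_right lbr_left)
  then show ?thesis
    using lbr_self[of "x + y"] by (simp add: eq_neg_iff_add_eq_0 add.commute)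
qed

text \<open>The Jacobi identity in the form ad [x, y] = [ad x, ad y].\<close>

lemma lbr_lbr: "lbr (lbr x y) z = lbr x (lbr y z) - lbr y (lbr x z)"
proof -
  have "lbr x (lbr y z) + lbr y (lbr z x) + lbr z (lbr x y) = 0"
    using graded unfolding bc2_graded_lie_def lie_algebra_def by simp
  moreover have "lbr z (lbr x y) = - lbr (lbr x y) z" "lbr y (lbr z x) = - lbr y (lbr x z)"
    using lbr_anti[of z "lbr x y"] lbr_anti[of z x] by (simp_all add: lbr_right)
  ultimately show ?thesis
    by (simp add: algebra_simps)
qed

section \<open>Homogeneous components and the grading by rows\<close>

lemma direct_sum: "internal_direct_sum (lscal L) UNIV (lcomp L)"
  using graded unfolding bc2_graded_lie_def by blast

lemma subspace_lcomp: "subspace (lcomp L \<alpha>)"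
  using direct_sum unfolding internal_direct_sum_def by blast

lemma lcomp_bracket: "x \<in> lcomp L \<alpha> \<Longrightarrow> y \<in> lcomp L \<beta> \<Longrightarrow> lbr x y \<in> lcomp L (\<alpha> + \<beta>)"
  using graded unfolding bc2_graded_lie_def by blast

lemma lcomp_nonroot: "\<alpha> \<notin> bc2_roots \<union> {0} \<Longrightarrow> lcomp L \<alpha> = {0}"
  using graded unfolding bc2_graded_lie_def by blast

text \<open>The only roots whose first coordinate is 1 or -1 are the four short ones.\<close>

lemma lcomp_row_other:
  assumes "\<sigma> \<in> signs" "j \<notin> {0, 1}"
  shows "lcomp L (\<sigma>, \<sigma> * j) = {0}"
proof (rule lcomp_nonroot)
  show "(\<sigma>, \<sigma> * j) \<notin> bc2_roots \<union> {0}"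
    unfolding bc2_roots_zero using assms by (elim insertE emptyE; simp)
qed

lemma lcomp_disjoint:
  assumes "\<alpha> \<noteq> \<beta>"
  shows "lcomp L \<alpha> \<inter> lcomp L \<beta> = {0}"
  using internal_direct_sum_span_disjoint[OF module_axioms direct_sum, of "{\<alpha>}" "{\<beta>}"] assms
  by (simp add: span_eq_iff[THEN iffD2, OF subspace_lcomp])

lemma subspace_lrow: "subspace (lrow L i)"
  unfolding lrow_def by (rule subspace_span)

lemma lcomp_subset_lrow: "lcomp L (i, j) \<subseteq> lrow L i"
  unfolding lrow_def by (auto intro: span_base)

lemma lrow_disjoint:
  assumes "i \<noteq> j"
  shows "lrow L i \<inter> lrow L j = {0}"
proof -
  have row: "lrow L k = span (\<Union>\<alpha>\<in>{k} \<times> UNIV. lcomp L \<alpha>)" for k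
    unfolding lrow_def by (rule arg_cong[of _ _ span]) auto
  show ?thesis
    unfolding row[of i] row[of j]
    by (rule internal_direct_sum_span_disjoint[OF module_axioms direct_sum]) (use assms in auto)
qed

lemma lrow_eq:
  assumes "\<sigma> \<in> signs"
  shows "lrow L \<sigma> = {x + y | x y. x \<in> lcomp L (\<sigma>, 0) \<and> y \<in> lcomp L (\<sigma>, \<sigma>)}"
proof -
  have "lcomp L (\<sigma>, j) \<subseteq> lcomp L (\<sigma>, 0) \<union> lcomp L (\<sigma>, \<sigma>)" for j
  proof -
    have j: "\<sigma> * (\<sigma> * j) = j"
      using assms by auto
    show ?thesis
    proof (cases "\<sigma> * j \<in> {0, 1}")
      case True
      then have "j = 0 \<or> j = \<sigma>"
        using j assms by auto
      then show ?thesis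
        by auto
    next
      case False
      then show ?thesis
        using lcomp_row_other[OF assms False] subspace_0[OF subspace_lcomp] by (simp add: j)
    qed
  qed
  then have "(\<Union>j. lcomp L (\<sigma>, j)) = lcomp L (\<sigma>, 0) \<union> lcomp L (\<sigma>, \<sigma>)"
    by blast
  then show ?thesis
    unfolding lrow_def
    by (simp only: span_Un span_eq_iff[THEN iffD2, OF subspace_lcomp])
qed

text \<open>The rows form a 5-grading of \<open>L\<close>, in degrees -2 to 2.\<close>

lemma lrow_high:
  assumes "\<bar>i\<bar> > 2"
  shows "lrow L i = {0}"
proof -
  have "lcomp L (i, j) = {0}" for j
  proof (rule lcomp_nonroot)
    show "(i, j) \<notin> bc2_roots \<union> {0}"
      unfolding bc2_roots_zero using assms by (intro notI; elim insertE emptyE; simp)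
  qed
  then show ?thesis
    unfolding lrow_def by (simp add: span_eq_iff[THEN iffD2, OF subspace_single_0])
qed

lemma lrow_bracket:
  assumes x: "x \<in> lrow L i" and y: "y \<in> lrow L j"
  shows "lbr x y \<in> lrow L (i + j)"
proof -
  \<comment> \<open>Bilinearity is used one argument at a time: here x' is homogeneous and y varies
    in a span.\<close>
  have homog: "lbr x' y \<in> lrow L (i + j)" if "x' \<in> lcomp L (i, k)" for x' k
    using y unfolding lrow_def
  proof (induction rule: span_induct_alt)
    case base
    then show ?case
      by (simp add: lbr_right span_zero)
  next
    case (step c z w)
    then obtain l where "z \<in> lcomp L (j, l)"
      by blast
    then have "lbr x' z \<in> lcomp L (i + j, k + l)"
      using lcomp_bracket[OF that, of z "(j, l)"] by simp
    then have "lbr x' z \<in> span (\<Union>l. lcomp L (i + j, l))"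
      by (intro span_base) blast
    then show ?case
      using step by (simp add: lbr_right span_add span_scale)
  qed
  show ?thesis
    using x unfolding lrow_def[of L i]
  proof (induction rule: span_induct_alt)
    case base
    then show ?case
      by (simp add: lbr_left subspace_0 subspace_lrow)
  next
    case (step c z w)
    then obtain l where "z \<in> lcomp L (i, l)"
      by blast
    then have "lbr z y \<in> lrow L (i + j)"
      by (rule homog)
    then show ?case
      using step by (simp add: lbr_left subspace_add subspace_scale subspace_lrow)
  qed
qed

lemma lrow_double_bracket:
  assumes "x \<in> lrow L i" "y \<in> lrow L j" "z \<in> lrow L k" "i + j + k = l"
  shows "lbr (lbr x y) z \<in> lrow L l"
  unfolding assms(4)[symmetric] by (intro lrow_bracket assms)

lemma bracket_three_zero:
  assumes "\<sigma> \<in> signs" "x \<in> lrow L \<sigma>" "y \<in> lrow L \<sigma>" "z \<in> lrow L \<sigma>"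
  shows "lbr (lbr x y) z = 0"
proof -
  have "lrow L (\<sigma> + \<sigma> + \<sigma>) = {0}"
    using assms(1) by (intro lrow_high) auto
  then show ?thesis
    using lrow_double_bracket[OF assms(2-4) refl] by blast
qed

text \<open>By the Jacobi identity the operator K(x, z) is ad [x, z], so that (K2) becomes an
  identity between ad operators.\<close>

lemma Kop_enveloped: "Kop (enveloped_pair L) \<sigma> x z y = lbr (lbr x z) y"
proof -
  have "lbr (lbr x y) z - lbr (lbr z y) x = lbr (lbr x z) y"
    using lbr_lbr[of x z y] lbr_anti[of "lbr x y" z] lbr_anti[of "lbr z y" x] by simp
  then show ?thesis
    by (simp add: Kop_def enveloped_pair_def)
qed

lemma kantor_enveloped: "kantor_pair (enveloped_pair L)"
proof -
  have tri: "trilinear_pair (enveloped_pair L)"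
    unfolding trilinear_pair_def enveloped_pair_def
    by (simp add: module_axioms subspace_lrow lbr_left lbr_right lrow_double_bracket)
  \<comment> \<open>D(x, y) is ad [x, y], and (K1) says that this derivation acts on [z, w] by the
    product rule. No degrees enter.\<close>
  have K1: "lbr (lbr x y) (lbr (lbr z w) v) - lbr (lbr z w) (lbr (lbr x y) v)
      = lbr (lbr (lbr (lbr x y) z) w) v - lbr (lbr z (lbr (lbr y x) w)) v" for x y z w v
  proof -
    have "lbr (lbr x y) (lbr z w) = lbr (lbr (lbr x y) z) w + lbr z (lbr (lbr x y) w)"
      using lbr_lbr[of "lbr x y" z w] by (simp add: algebra_simps)
    also have "lbr z (lbr (lbr x y) w) = - lbr z (lbr (lbr y x) w)"
      using lbr_anti[of x y] by (simp add: lbr_left lbr_right)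
    finally have "lbr (lbr x y) (lbr z w) = lbr (lbr (lbr x y) z) w - lbr z (lbr (lbr y x) w)"
      by simp
    then show ?thesis
      using lbr_lbr[of "lbr x y" "lbr z w" v] by (simp add: lbr_left)
  qed
  \<comment> \<open>Applying ad [x, z] to [w, u] also yields [w, [[x, z], u]]. This term vanishes
    because [[x, z], u] has row degree 3 \<sigma>.\<close>
  have K2: "lbr (lbr x z) (lbr (lbr w u) v) + lbr (lbr u w) (lbr (lbr x z) v)
      = lbr (lbr (lbr (lbr x z) w) u) v"
    if "\<sigma> \<in> signs" "x \<in> lrow L \<sigma>" "z \<in> lrow L \<sigma>" "u \<in> lrow L \<sigma>" for \<sigma> x z u w v
  proof -
    have "lbr (lbr x z) (lbr w u) = lbr (lbr (lbr x z) w) u"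
      using lbr_lbr[of "lbr x z" w u] bracket_three_zero[OF that] by (simp add: lbr_right)
    moreover have "lbr (lbr u w) (lbr (lbr x z) v) = - lbr (lbr w u) (lbr (lbr x z) v)"
      using lbr_anti[of w u] by (simp add: lbr_left)
    ultimately show ?thesis
      using lbr_lbr[of "lbr x z" "lbr w u" v] by simp
  qed
  show ?thesis
    unfolding kantor_pair_def Kop_enveloped Dop_def
    using tri K2 by (simp add: enveloped_pair_def K1)
qed

lemma sp_graded_enveloped: "sp_graded_kantor_pair (enveloped_pair L)"
proof -
  have "internal_direct_sum (lscal L) (lrow L \<sigma>) (\<lambda>i. lcomp L (\<sigma>, \<sigma> * i))" if "\<sigma> \<in> signs" for \<sigma>
  proof (rule internal_direct_sum_two[OF module_axioms])
    show "lcomp L (\<sigma>, \<sigma> * 0) \<inter> lcomp L (\<sigma>, \<sigma> * 1) = {0}"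
      using that by (intro lcomp_disjoint) auto
  qed (use that subspace_lcomp lcomp_row_other lrow_eq in auto)
  moreover have "lbr (lbr x y) z \<in> lcomp L (\<sigma>, \<sigma> * (i - j + k))"
    if "x \<in> lcomp L (\<sigma>, \<sigma> * i)" "y \<in> lcomp L (- \<sigma>, - \<sigma> * j)" "z \<in> lcomp L (\<sigma>, \<sigma> * k)"
    for \<sigma> i j k x y z
    using lcomp_bracket[OF lcomp_bracket[OF that(1,2)] that(3)] by (simp add: algebra_simps)
  ultimately show ?thesis
    unfolding sp_graded_kantor_pair_def
    using kantor_enveloped lcomp_row_other by (simp add: enveloped_pair_def)
qed

text \<open>The odd part of the 5-grading: T_L(P) described inside \<open>L\<close>, without mention
  of a pair.\<close>

definition odd_part :: "'l set" where
  "odd_part = {x + y | x y. x \<in> lrow L (-1) \<and> y \<in> lrow L 1}"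

text \<open>Every component of rows -1 and 1 outside the short roots is zero. In contrast to the
  rows, the set of short roots is visibly stable under the Weyl group.\<close>

lemma odd_part_span: "odd_part = span (\<Union>\<alpha>\<in>short_roots. lcomp L \<alpha>)"
proof -
  have "odd_part = span ((\<Union>j. lcomp L (-1, j)) \<union> (\<Union>j. lcomp L (1, j)))"
    unfolding odd_part_def lrow_def span_Un ..
  also have "\<dots> = span (\<Union>\<alpha>\<in>short_roots. lcomp L \<alpha>)"
  proof (rule span_eq[THEN iffD2], rule conjI)
    have "lcomp L (\<sigma>, j) \<subseteq> span (\<Union>\<alpha>\<in>short_roots. lcomp L \<alpha>)" if "\<sigma> \<in> signs" for \<sigma> j
    proof (cases "(\<sigma>, j) \<in> short_roots")
      case True
      then show ?thesis
        by (auto intro: span_base)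
    next
      case False
      then have "lcomp L (\<sigma>, j) = {0}"
        using that by (intro lcomp_nonroot)
          (unfold bc2_roots_zero short_roots_def, elim insertE emptyE; simp)
      then show ?thesis
        by (simp add: span_zero)
    qed
    then show "(\<Union>j. lcomp L (-1, j)) \<union> (\<Union>j. lcomp L (1, j))
        \<subseteq> span (\<Union>\<alpha>\<in>short_roots. lcomp L \<alpha>)"
      by blast
    show "(\<Union>\<alpha>\<in>short_roots. lcomp L \<alpha>)
        \<subseteq> span ((\<Union>j. lcomp L (-1, j)) \<union> (\<Union>j. lcomp L (1, j)))"
      unfolding short_roots_def by (auto intro!: span_base)
  qed
  finally show ?thesis .
qed

lemma bc2_graded_weyl:
  assumes u: "u \<in> weyl_group"
  shows "bc2_graded_lie (weyl_lie u L)"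
proof -
  have v: "inv_into UNIV u \<in> signed_perms" "u \<in> signed_perms"
    using u weyl_group_inv weyl_group_signed_perm by blast+
  have uv: "u (inv_into UNIV u \<alpha>) = \<alpha>" for \<alpha>
    using weyl_group_bij[OF u] by (simp add: bij_is_surj surj_f_inv_f)
  have "lie_algebra (weyl_lie u L)"
    using graded by (simp add: bc2_graded_lie_def lie_algebra_def weyl_lie_def)
  moreover have "internal_direct_sum (lscal L) UNIV (\<lambda>\<alpha>. lcomp L (inv_into UNIV u \<alpha>))"
    by (rule internal_direct_sum_reindex[OF direct_sum])
      (rule weyl_group_bij[OF weyl_group_inv[OF u]])
  moreover have "lbr x y \<in> lcomp L (inv_into UNIV u (\<alpha> + \<beta>))"
    if "x \<in> lcomp L (inv_into UNIV u \<alpha>)" "y \<in> lcomp L (inv_into UNIV u \<beta>)" for x y \<alpha> \<beta>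
    unfolding signed_perms_add[OF v(1)] by (rule lcomp_bracket[OF that])
  \<comment> \<open>If the inverse image of \<alpha> were a root or 0, then u would carry it back to
    \<alpha>, which would be a root or 0 as well.\<close>
  moreover have "lcomp L (inv_into UNIV u \<alpha>) = {0}" if "\<alpha> \<notin> bc2_roots \<union> {0}" for \<alpha>
    using signed_perms_roots[OF v(2), of "inv_into UNIV u \<alpha>"] that
    by (intro lcomp_nonroot) (auto simp: uv)
  ultimately show ?thesis
    by (simp add: bc2_graded_lie_def weyl_lie_def)
qed

lemma odd_part_weyl:
  assumes u: "u \<in> weyl_group"
  shows "bc2_lie.odd_part (weyl_lie u L) = odd_part"
proof -
  interpret W: bc2_lie "weyl_lie u L"
    by unfold_locales (rule bc2_graded_weyl[OF u])
  have "(\<Union>\<alpha>\<in>short_roots. lcomp (weyl_lie u L) \<alpha>)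
      = (\<Union>\<alpha>\<in>inv_into UNIV u ` short_roots. lcomp L \<alpha>)"
    by (simp add: weyl_lie_def)
  then have "(\<Union>\<alpha>\<in>short_roots. lcomp (weyl_lie u L) \<alpha>) = (\<Union>\<alpha>\<in>short_roots. lcomp L \<alpha>)"
    using signed_perms_short_roots[OF weyl_group_signed_perm[OF weyl_group_inv[OF u]]] by simp
  moreover have "lscal (weyl_lie u L) = lscal L"
    by (simp add: weyl_lie_def)
  ultimately show ?thesis
    unfolding W.odd_part_span odd_part_span by simp
qed

lemma subspace_odd_part: "subspace odd_part"
  unfolding odd_part_span by (rule subspace_span)

lemma lrow_subset_odd_part:
  assumes "\<sigma> \<in> signs"
  shows "lrow L \<sigma> \<subseteq> odd_part"
proof -
  have "lrow L (-1) \<union> lrow L 1 \<subseteq> span (lrow L (-1) \<union> lrow L 1)"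
    by (rule span_superset)
  also have "\<dots> = odd_part"
    unfolding odd_part_def span_Un span_eq_iff[THEN iffD2, OF subspace_lrow] ..
  finally show ?thesis
    using assms by auto
qed

end

section \<open>A pair P identified with the odd part of an enveloping Lie algebra\<close>

lemma weyl_pair_fields:
  "part (weyl_pair u L) = lrow (weyl_lie u L)"
  "scal (weyl_pair u L) = lscal L"
  "tprod (weyl_pair u L) \<sigma> x y z = bracket L (bracket L x y) z"
  by (simp_all add: weyl_pair_def enveloped_pair_def weyl_lie_def)

locale enveloping =
  fixes L :: "('k::comm_ring_1, 'l::ab_group_add) graded_lie"
    and \<iota> :: "int \<Rightarrow> 'p::ab_group_add \<Rightarrow> 'l"
    and P :: "('k, 'p) sp_pair"
  assumes env: "envelops L \<iota> P"
begin

sublocale bc2_lie L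
  using env by unfold_locales (simp add: envelops_def)

sublocale P: module "scal P"
  using env by (simp add: envelops_def sp_graded_kantor_pair_def kantor_pair_def trilinear_pair_def)

lemma trilinear_P: "trilinear_pair P"
  using env by (simp add: envelops_def sp_graded_kantor_pair_def kantor_pair_def)

lemma subspace_part: "\<sigma> \<in> signs \<Longrightarrow> P.subspace (part P \<sigma>)"
  using trilinear_P unfolding trilinear_pair_def by (simp del: ball_simps insert_iff)

lemma tprod_part:
  "\<sigma> \<in> signs \<Longrightarrow> x \<in> part P \<sigma> \<Longrightarrow> y \<in> part P (-\<sigma>) \<Longrightarrow> z \<in> part P \<sigma> \<Longrightarrow> tprod P \<sigma> x y z \<in> part P \<sigma>"
  using trilinear_P unfolding trilinear_pair_def by (simp del: ball_simps insert_iff)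

lemma pcomp_part:
  assumes "\<sigma> \<in> signs" "x \<in> pcomp P \<sigma> i"
  shows "x \<in> part P \<sigma>"
proof -
  have "internal_direct_sum (scal P) (part P \<sigma>) (pcomp P \<sigma>)"
    using env assms(1) unfolding envelops_def sp_graded_kantor_pair_def
    by (simp del: ball_simps insert_iff)
  then have "pcomp P \<sigma> i \<subseteq> part P \<sigma>"
    by (simp add: internal_direct_sum_def)
  then show ?thesis
    using assms(2) by (rule subsetD)
qed

lemma iso:
  assumes "\<sigma> \<in> signs"
  shows iota_bij: "bij_betw (\<iota> \<sigma>) (part P \<sigma>) (lrow L \<sigma>)"
    and iota_add: "\<And>x y. x \<in> part P \<sigma> \<Longrightarrow> y \<in> part P \<sigma> \<Longrightarrow> \<iota> \<sigma> (x + y) = \<iota> \<sigma> x + \<iota> \<sigma> y"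
    and iota_scale: "\<And>c x. x \<in> part P \<sigma> \<Longrightarrow> \<iota> \<sigma> (scal P c x) = lscal L c (\<iota> \<sigma> x)"
    and iota_tprod: "\<And>x y z. x \<in> part P \<sigma> \<Longrightarrow> y \<in> part P (-\<sigma>) \<Longrightarrow> z \<in> part P \<sigma> \<Longrightarrow>
          \<iota> \<sigma> (tprod P \<sigma> x y z) = lbr (lbr (\<iota> \<sigma> x) (\<iota> (-\<sigma>) y)) (\<iota> \<sigma> z)"
    and iota_pcomp: "\<And>i. \<iota> \<sigma> ` pcomp P \<sigma> i = lcomp L (\<sigma>, \<sigma> * i)"
proof -
  have "sp_isomorphism P (enveloped_pair L) \<iota>"
    using env by (simp add: envelops_def)
  note * = bspec[OF this[unfolded sp_isomorphism_def] assms, unfolded enveloped_pair_def, simplified]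
  show "bij_betw (\<iota> \<sigma>) (part P \<sigma>) (lrow L \<sigma>)"
    using * by simp
  show "\<And>x y. x \<in> part P \<sigma> \<Longrightarrow> y \<in> part P \<sigma> \<Longrightarrow> \<iota> \<sigma> (x + y) = \<iota> \<sigma> x + \<iota> \<sigma> y"
    using * by simp
  show "\<And>c x. x \<in> part P \<sigma> \<Longrightarrow> \<iota> \<sigma> (scal P c x) = lscal L c (\<iota> \<sigma> x)"
    using * by simp
  show "\<And>x y z. x \<in> part P \<sigma> \<Longrightarrow> y \<in> part P (-\<sigma>) \<Longrightarrow> z \<in> part P \<sigma> \<Longrightarrow>
          \<iota> \<sigma> (tprod P \<sigma> x y z) = lbr (lbr (\<iota> \<sigma> x) (\<iota> (-\<sigma>) y)) (\<iota> \<sigma> z)"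
    using * by simp
  show "\<And>i. \<iota> \<sigma> ` pcomp P \<sigma> i = lcomp L (\<sigma>, \<sigma> * i)"
    using * by simp
qed

lemma iota_lrow: "\<sigma> \<in> signs \<Longrightarrow> x \<in> part P \<sigma> \<Longrightarrow> \<iota> \<sigma> x \<in> lrow L \<sigma>"
  using iota_bij bij_betwE by metis

lemma iota_diff:
  assumes "\<sigma> \<in> signs" "x \<in> part P \<sigma>" "y \<in> part P \<sigma>"
  shows "\<iota> \<sigma> (x - y) = \<iota> \<sigma> x - \<iota> \<sigma> y"
  using iota_add[OF assms(1) P.subspace_diff[OF subspace_part[OF assms(1)] assms(2,3)] assms(3)]
  by simp

lemma iota_zero: "\<sigma> \<in> signs \<Longrightarrow> \<iota> \<sigma> 0 = 0"
  using iota_diff[of \<sigma> 0 0] P.subspace_0[OF subspace_part] by simp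

lemma iota_neg: "\<sigma> \<in> signs \<Longrightarrow> x \<in> part P \<sigma> \<Longrightarrow> \<iota> \<sigma> (- x) = - \<iota> \<sigma> x"
  using iota_diff[of \<sigma> 0 x] P.subspace_0[OF subspace_part] iota_zero by simp

lemma Kop_part:
  "\<sigma> \<in> signs \<Longrightarrow> x \<in> part P \<sigma> \<Longrightarrow> y \<in> part P \<sigma> \<Longrightarrow> z \<in> part P (-\<sigma>) \<Longrightarrow> Kop P \<sigma> x y z \<in> part P \<sigma>"
  unfolding Kop_def by (intro P.subspace_diff[OF subspace_part] tprod_part)

lemma bracket_same:
  "\<sigma> \<in> signs \<Longrightarrow> x \<in> part P \<sigma> \<Longrightarrow> y \<in> part P \<sigma> \<Longrightarrow> z \<in> part P \<sigma> \<Longrightarrow>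
     lbr (lbr (\<iota> \<sigma> x) (\<iota> \<sigma> y)) (\<iota> \<sigma> z) = 0"
  by (intro bracket_three_zero[of \<sigma>] iota_lrow)

lemma bracket_opposite:
  assumes "\<sigma> \<in> signs" "x \<in> part P (-\<sigma>)" "y \<in> part P \<sigma>" "z \<in> part P \<sigma>"
  shows "lbr (lbr (\<iota> (-\<sigma>) x) (\<iota> \<sigma> y)) (\<iota> \<sigma> z) = - \<iota> \<sigma> (tprod P \<sigma> y x z)"
  unfolding iota_tprod[OF assms(1,3,2,4)] lbr_anti[of "\<iota> (-\<sigma>) x" "\<iota> \<sigma> y"]
  by (simp add: lbr_left)

text \<open>\<iota> carries both products in K to double brackets, and \<open>Kop_enveloped\<close>
  collapses their difference to a single one.\<close>

lemma bracket_Kop: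
  assumes "\<sigma> \<in> signs" "x \<in> part P \<sigma>" "y \<in> part P \<sigma>" "z \<in> part P (-\<sigma>)"
  shows "lbr (lbr (\<iota> \<sigma> x) (\<iota> \<sigma> y)) (\<iota> (-\<sigma>) z) = \<iota> \<sigma> (Kop P \<sigma> x y z)"
proof -
  have "\<iota> \<sigma> (Kop P \<sigma> x y z) = \<iota> \<sigma> (tprod P \<sigma> x z y) - \<iota> \<sigma> (tprod P \<sigma> y z x)"
    unfolding Kop_def using assms by (intro iota_diff tprod_part)
  also have "\<dots> = Kop (enveloped_pair L) \<sigma> (\<iota> \<sigma> x) (\<iota> \<sigma> y) (\<iota> (-\<sigma>) z)"
    using assms by (simp add: iota_tprod Kop_def enveloped_pair_def)
  finally show ?thesis
    by (simp add: Kop_enveloped)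
qed

text \<open>At this point \<open>L\<close> drops out: the right-hand side refers only to \<iota> and
  the products of P.\<close>

lemma bracket_eq_double_bracket_in:
  assumes "\<tau>\<^sub>1 \<in> signs" "\<tau>\<^sub>2 \<in> signs" "\<tau>\<^sub>3 \<in> signs"
    and "x \<in> part P \<tau>\<^sub>1" "y \<in> part P \<tau>\<^sub>2" "z \<in> part P \<tau>\<^sub>3"
  shows "lbr (lbr (\<iota> \<tau>\<^sub>1 x) (\<iota> \<tau>\<^sub>2 y)) (\<iota> \<tau>\<^sub>3 z) = double_bracket_in \<iota> P \<tau>\<^sub>1 \<tau>\<^sub>2 \<tau>\<^sub>3 x y z"
proof -
  consider "\<tau>\<^sub>2 = \<tau>\<^sub>1" "\<tau>\<^sub>3 = \<tau>\<^sub>1" | "\<tau>\<^sub>2 = \<tau>\<^sub>1" "\<tau>\<^sub>3 = - \<tau>\<^sub>1" | "\<tau>\<^sub>2 = - \<tau>\<^sub>1" "\<tau>\<^sub>3 = \<tau>\<^sub>1" | "\<tau>\<^sub>1 = - \<tau>\<^sub>2" "\<tau>\<^sub>3 = \<tau>\<^sub>2"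
    using assms(1-3) by auto
  then show ?thesis
  proof cases
    case 1
    then show ?thesis
      using bracket_same assms by (simp add: double_bracket_in_def)
  next
    case 2
    then show ?thesis
      using bracket_Kop[of \<tau>\<^sub>1 x y z] assms by (auto simp: double_bracket_in_def)
  next
    case 3
    then show ?thesis
      using iota_tprod[of \<tau>\<^sub>1 x y z] assms by (auto simp: double_bracket_in_def)
  next
    case 4
    then show ?thesis
      using bracket_opposite[of \<tau>\<^sub>2 x y z] assms by (auto simp: double_bracket_in_def)
  qed
qed

lemma T_sub_odd_part: "T_sub \<iota> P = odd_part"
proof -
  have "lrow L \<sigma> = \<iota> \<sigma> ` part P \<sigma>" if "\<sigma> \<in> signs" for \<sigma>
    using iota_bij[OF that] by (simp add: bij_betw_def)
  then have "lrow L (-1) = \<iota> (-1) ` part P (-1)" "lrow L 1 = \<iota> 1 ` part P 1"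
    by simp_all
  then show ?thesis
    unfolding T_sub_def odd_part_def by auto
qed

text \<open>Rows -1 and 1 meet only in 0 and each \<iota> \<sigma> is injective on its part. This
  makes \<open>coords\<close> well defined.\<close>

lemma iota_sum_inject:
  assumes "x \<in> part P (-1)" "y \<in> part P 1" "x' \<in> part P (-1)" "y' \<in> part P 1"
    and "\<iota> (-1) x + \<iota> 1 y = \<iota> (-1) x' + \<iota> 1 y'"
  shows "x = x' \<and> y = y'"
proof -
  have e: "\<iota> (-1) x - \<iota> (-1) x' = \<iota> 1 y' - \<iota> 1 y"
    using assms(5) by (simp add: algebra_simps)
  have "\<iota> (-1) x - \<iota> (-1) x' \<in> lrow L (-1)" "\<iota> 1 y' - \<iota> 1 y \<in> lrow L 1"
    using assms by (simp_all add: subspace_diff[OF subspace_lrow] iota_lrow)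
  then have "\<iota> (-1) x - \<iota> (-1) x' \<in> lrow L (-1) \<inter> lrow L 1"
    using e by simp
  then have "\<iota> (-1) x - \<iota> (-1) x' = 0"
    using lrow_disjoint[of "-1" 1] by simp
  then have "\<iota> (-1) x = \<iota> (-1) x'" "\<iota> 1 y = \<iota> 1 y'"
    using e by simp_all
  then show ?thesis
    using assms iota_bij[of "-1"] iota_bij[of 1] unfolding bij_betw_def inj_on_def by simp
qed

text \<open>Reduces a property that is additive in one argument to elements coming from P^- or P^+.
  Case \<open>add\<close> offers membership in \<open>odd_part\<close> because
  \<open>transfer\<close> below is additive only there.\<close>

lemma odd_part_induct [consumes 1, case_names hom add]:
  assumes "v \<in> odd_part"
    and hom: "\<And>\<tau> x. \<tau> \<in> signs \<Longrightarrow> x \<in> part P \<tau> \<Longrightarrow> Q (\<iota> \<tau> x)"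
    and add: "\<And>a b. a \<in> odd_part \<Longrightarrow> b \<in> odd_part \<Longrightarrow> Q a \<Longrightarrow> Q b \<Longrightarrow> Q (a + b)"
  shows "Q v"
proof -
  obtain x y where v: "v = \<iota> (-1) x + \<iota> 1 y" "x \<in> part P (-1)" "y \<in> part P 1"
    using assms(1) unfolding T_sub_odd_part[symmetric] T_sub_def by auto
  then have "\<iota> (-1) x \<in> odd_part" "\<iota> 1 y \<in> odd_part"
    using lrow_subset_odd_part[of "-1"] lrow_subset_odd_part[of 1] iota_lrow[of "-1" x] iota_lrow[of 1 y]
    by auto
  then show ?thesis
    unfolding v(1) using v hom[of "-1" x] hom[of 1 y] by (intro add) simp_all
qed

lemma iota_odd_part: "\<tau> \<in> signs \<Longrightarrow> x \<in> part P \<tau> \<Longrightarrow> \<iota> \<tau> x \<in> odd_part"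
  using lrow_subset_odd_part iota_lrow by (meson subsetD)

text \<open>Inverse of the parametrisation of T_L(P) by pairs from P^- and P^+; unspecified outside
  \<open>odd_part\<close>.\<close>

definition coords :: "'l \<Rightarrow> 'p \<times> 'p" where
  "coords v = (SOME p. fst p \<in> part P (-1) \<and> snd p \<in> part P 1 \<and> v = \<iota> (-1) (fst p) + \<iota> 1 (snd p))"

lemma coords_eq:
  assumes "x \<in> part P (-1)" "y \<in> part P 1"
  shows "coords (\<iota> (-1) x + \<iota> 1 y) = (x, y)"
  unfolding coords_def
proof (rule some_equality)
  fix p
  assume p: "fst p \<in> part P (-1) \<and> snd p \<in> part P 1 \<and> \<iota> (-1) x + \<iota> 1 y = \<iota> (-1) (fst p) + \<iota> 1 (snd p)"
  then have "x = fst p \<and> y = snd p"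
    using assms by (intro iota_sum_inject) auto
  then show "p = (x, y)"
    by (simp add: prod_eq_iff)
qed (use assms in simp)

text \<open>The component of sign \<sigma> and index i is \<open>lcomp L\<close> at the inverse
  image of (\<sigma>, \<sigma> * i), and \<open>weyl_data_inv\<close> rewrites this degree as one
  belonging to P.\<close>

lemma pcomp_weyl:
  assumes "u \<in> weyl_group" "weyl_data u \<pi> \<rho> a b" "\<sigma> \<in> signs"
  shows "pcomp (weyl_pair u L) \<sigma> 0 = \<iota> (\<pi> * \<sigma>) ` pcomp P (\<pi> * \<sigma>) a"
    and "pcomp (weyl_pair u L) \<sigma> 1 = \<iota> (\<rho> * \<sigma>) ` pcomp P (\<rho> * \<sigma>) b"
proof -
  have s: "\<pi> * \<sigma> \<in> signs" "\<rho> * \<sigma> \<in> signs"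
    using assms(2,3) unfolding weyl_data_def by auto
  show "pcomp (weyl_pair u L) \<sigma> 0 = \<iota> (\<pi> * \<sigma>) ` pcomp P (\<pi> * \<sigma>) a"
    "pcomp (weyl_pair u L) \<sigma> 1 = \<iota> (\<rho> * \<sigma>) ` pcomp P (\<rho> * \<sigma>) b"
    unfolding iota_pcomp[OF s(1)] iota_pcomp[OF s(2)] weyl_data_inv[OF assms(1,2), symmetric]
    by (simp_all add: weyl_pair_def enveloped_pair_def weyl_lie_def)
qed

text \<open>Besides being a claim of the theorem, this makes the facts of \<open>enveloping\<close>
  available for the Weyl image itself.\<close>

lemma envelops_weyl:
  assumes "u \<in> weyl_group"
  shows "envelops (weyl_lie u L) (\<lambda>_ x. x) (weyl_pair u L)"
proof -
  interpret W: bc2_lie "weyl_lie u L"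
    by unfold_locales (rule bc2_graded_weyl[OF assms])
  show ?thesis
    unfolding envelops_def weyl_pair_def
    using W.graded W.sp_graded_enveloped
    by (simp add: sp_isomorphism_def enveloped_pair_def bij_betw_def)
qed

lemma T_sub_weyl:
  assumes "u \<in> weyl_group"
  shows "T_sub (\<lambda>_ x. x) (weyl_pair u L) = T_sub \<iota> P"
proof -
  interpret W: enveloping "weyl_lie u L" "\<lambda>_ x. x" "weyl_pair u L"
    by unfold_locales (rule envelops_weyl[OF assms])
  show ?thesis
    unfolding W.T_sub_odd_part T_sub_odd_part by (rule odd_part_weyl[OF assms])
qed

text \<open>Generation and the condition on the centre depend only on the bracket, the scalars and
  T_L(P), and the regrading changes none of them.\<close>

lemma tightly_envelops_weyl:
  assumes "u \<in> weyl_group" "tightly_envelops L \<iota> P"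
  shows "tightly_envelops (weyl_lie u L) (\<lambda>_ x. x) (weyl_pair u L)"
proof -
  have "lie_subalgebra (weyl_lie u L) = lie_subalgebra L"
    "lie_center (weyl_lie u L) = lie_center L"
    "bracket_span (weyl_lie u L) = bracket_span L"
    by (simp_all add: weyl_lie_def lie_subalgebra_def lie_center_def bracket_span_def fun_eq_iff)
  then show ?thesis
    using assms(2) envelops_weyl[OF assms(1)]
    unfolding tightly_envelops_def T_sub_weyl[OF assms(1)] by simp
qed

end

section \<open>Comparison of two enveloping Lie algebras\<close>

locale two_envelopes =
  A: enveloping L \<iota> P + B: enveloping L' \<iota>' P
  for L :: "('k::comm_ring_1, 'l::ab_group_add) graded_lie"
    and \<iota> :: "int \<Rightarrow> 'p::ab_group_add \<Rightarrow> 'l"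
    and L' :: "('k, 'm::ab_group_add) graded_lie"
    and \<iota>' :: "int \<Rightarrow> 'p \<Rightarrow> 'm"
    and P :: "('k, 'p) sp_pair"
begin

text \<open>The identification of T_L(P) with T_L'(P) through P. It is one map for both signs and
  for every u, and it is meaningful only on \<open>A.odd_part\<close>.\<close>

definition transfer :: "'l \<Rightarrow> 'm" where
  "transfer v = \<iota>' (-1) (fst (A.coords v)) + \<iota>' 1 (snd (A.coords v))"

lemma transfer_eq:
  "x \<in> part P (-1) \<Longrightarrow> y \<in> part P 1 \<Longrightarrow> transfer (\<iota> (-1) x + \<iota> 1 y) = \<iota>' (-1) x + \<iota>' 1 y"
  unfolding transfer_def by (simp add: A.coords_eq)

lemma odd_part_cases:
  assumes "v \<in> A.odd_part"
  obtains x y where "v = \<iota> (-1) x + \<iota> 1 y" "x \<in> part P (-1)" "y \<in> part P 1"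
  using assms unfolding A.T_sub_odd_part[symmetric] T_sub_def by auto

lemma transfer_iota:
  assumes "\<tau> \<in> signs" "x \<in> part P \<tau>"
  shows "transfer (\<iota> \<tau> x) = \<iota>' \<tau> x"
proof -
  have z: "0 \<in> part P (-1)" "0 \<in> part P 1"
    using A.P.subspace_0[OF A.subspace_part] by simp_all
  have "transfer (\<iota> (-1) x + \<iota> 1 0) = \<iota>' (-1) x + \<iota>' 1 0" if "\<tau> = -1"
    using assms that z by (intro transfer_eq) simp_all
  moreover have "transfer (\<iota> (-1) 0 + \<iota> 1 x) = \<iota>' (-1) 0 + \<iota>' 1 x" if "\<tau> = 1"
    using assms that z by (intro transfer_eq) simp_all
  ultimately show ?thesis
    using assms(1) by (auto simp: A.iota_zero B.iota_zero)
qed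

lemma transfer_add:
  assumes "v \<in> A.odd_part" "w \<in> A.odd_part"
  shows "transfer (v + w) = transfer v + transfer w"
proof -
  obtain x y where v: "v = \<iota> (-1) x + \<iota> 1 y" "x \<in> part P (-1)" "y \<in> part P 1"
    using assms(1) by (rule odd_part_cases)
  obtain x' y' where w: "w = \<iota> (-1) x' + \<iota> 1 y'" "x' \<in> part P (-1)" "y' \<in> part P 1"
    using assms(2) by (rule odd_part_cases)
  have p: "x + x' \<in> part P (-1)" "y + y' \<in> part P 1"
    using v w by (simp_all add: A.P.subspace_add[OF A.subspace_part])
  have "v + w = \<iota> (-1) (x + x') + \<iota> 1 (y + y')"
    using v w by (simp add: A.iota_add algebra_simps)
  then have "transfer (v + w) = \<iota>' (-1) (x + x') + \<iota>' 1 (y + y')"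
    by (simp add: transfer_eq[OF p])
  also have "\<dots> = transfer v + transfer w"
    unfolding v(1) w(1) transfer_eq[OF v(2,3)] transfer_eq[OF w(2,3)]
    using v w by (simp add: B.iota_add algebra_simps)
  finally show ?thesis .
qed

lemma transfer_scale:
  assumes "v \<in> A.odd_part"
  shows "transfer (lscal L c v) = lscal L' c (transfer v)"
proof -
  obtain x y where v: "v = \<iota> (-1) x + \<iota> 1 y" "x \<in> part P (-1)" "y \<in> part P 1"
    using assms(1) by (rule odd_part_cases)
  have p: "scal P c x \<in> part P (-1)" "scal P c y \<in> part P 1"
    using v by (simp_all add: A.P.subspace_scale[OF A.subspace_part])
  have "lscal L c v = \<iota> (-1) (scal P c x) + \<iota> 1 (scal P c y)"
    using v by (simp add: A.iota_scale A.scale_right_distrib)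
  then have "transfer (lscal L c v) = \<iota>' (-1) (scal P c x) + \<iota>' 1 (scal P c y)"
    by (simp add: transfer_eq[OF p])
  also have "\<dots> = lscal L' c (transfer v)"
    unfolding v(1) transfer_eq[OF v(2,3)]
    using v by (simp add: B.iota_scale B.scale_right_distrib)
  finally show ?thesis .
qed

lemma transfer_inj: "inj_on transfer A.odd_part"
proof (rule inj_onI)
  fix v w
  assume "v \<in> A.odd_part" "w \<in> A.odd_part" and e: "transfer v = transfer w"
  obtain x y where v: "v = \<iota> (-1) x + \<iota> 1 y" "x \<in> part P (-1)" "y \<in> part P 1"
    using \<open>v \<in> A.odd_part\<close> by (rule odd_part_cases)
  obtain x' y' where w: "w = \<iota> (-1) x' + \<iota> 1 y'" "x' \<in> part P (-1)" "y' \<in> part P 1"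
    using \<open>w \<in> A.odd_part\<close> by (rule odd_part_cases)
  have "x = x' \<and> y = y'"
    using e unfolding v(1) w(1) transfer_eq[OF v(2,3)] transfer_eq[OF w(2,3)]
    by (rule B.iota_sum_inject[OF v(2,3) w(2,3)])
  then show "v = w"
    by (simp add: v(1) w(1))
qed

lemma transfer_double_bracket_in:
  assumes s: "\<tau>\<^sub>1 \<in> signs" "\<tau>\<^sub>2 \<in> signs" "\<tau>\<^sub>3 \<in> signs"
    and p: "x \<in> part P \<tau>\<^sub>1" "y \<in> part P \<tau>\<^sub>2" "z \<in> part P \<tau>\<^sub>3"
  shows "double_bracket_in \<iota> P \<tau>\<^sub>1 \<tau>\<^sub>2 \<tau>\<^sub>3 x y z \<in> A.odd_part"
    and "transfer (double_bracket_in \<iota> P \<tau>\<^sub>1 \<tau>\<^sub>2 \<tau>\<^sub>3 x y z) = double_bracket_in \<iota>' P \<tau>\<^sub>1 \<tau>\<^sub>2 \<tau>\<^sub>3 x y z"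
proof -
  \<comment> \<open>Both double brackets come from the same element t of P with sign \<tau>. The
    value 0 and the minus sign of the last pattern are moved inside \<iota>, where they no longer
    depend on the Lie algebra.\<close>
  define t where "t = (if \<tau>\<^sub>1 = \<tau>\<^sub>2 then (if \<tau>\<^sub>3 = \<tau>\<^sub>1 then 0 else Kop P \<tau>\<^sub>1 x y z)
      else (if \<tau>\<^sub>3 = \<tau>\<^sub>1 then tprod P \<tau>\<^sub>1 x y z else - tprod P \<tau>\<^sub>2 y x z))"
  define \<tau> where "\<tau> = (if \<tau>\<^sub>1 = \<tau>\<^sub>2 \<or> \<tau>\<^sub>3 = \<tau>\<^sub>1 then \<tau>\<^sub>1 else \<tau>\<^sub>2)"
  have \<tau>: "\<tau> \<in> signs"
    using s by (simp add: \<tau>_def)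
  have K: "Kop P \<tau>\<^sub>1 x y z \<in> part P \<tau>\<^sub>1" if "\<tau>\<^sub>1 = \<tau>\<^sub>2" "\<tau>\<^sub>3 \<noteq> \<tau>\<^sub>1"
    using s p that by (intro A.Kop_part) auto
  have D: "tprod P \<tau>\<^sub>1 x y z \<in> part P \<tau>\<^sub>1" if "\<tau>\<^sub>1 \<noteq> \<tau>\<^sub>2" "\<tau>\<^sub>3 = \<tau>\<^sub>1"
    using s p that by (intro A.tprod_part) auto
  have D': "tprod P \<tau>\<^sub>2 y x z \<in> part P \<tau>\<^sub>2" if "\<tau>\<^sub>1 \<noteq> \<tau>\<^sub>2" "\<tau>\<^sub>3 \<noteq> \<tau>\<^sub>1"
    using s p that by (intro A.tprod_part) auto
  have t: "t \<in> part P \<tau>"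
    using K D D' A.P.subspace_0[OF A.subspace_part[OF s(1)]]
      A.P.subspace_0[OF A.subspace_part[OF s(2)]] A.P.subspace_neg[OF A.subspace_part[OF s(2)]]
    by (simp add: t_def \<tau>_def)
  have A: "double_bracket_in \<iota> P \<tau>\<^sub>1 \<tau>\<^sub>2 \<tau>\<^sub>3 x y z = \<iota> \<tau> t"
    using D' A.iota_neg[OF s(2)] A.iota_zero[OF s(1)] A.iota_zero[OF s(2)]
    by (simp add: double_bracket_in_def t_def \<tau>_def)
  have B: "double_bracket_in \<iota>' P \<tau>\<^sub>1 \<tau>\<^sub>2 \<tau>\<^sub>3 x y z = \<iota>' \<tau> t"
    using D' B.iota_neg[OF s(2)] B.iota_zero[OF s(1)] B.iota_zero[OF s(2)]
    by (simp add: double_bracket_in_def t_def \<tau>_def)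
  show "double_bracket_in \<iota> P \<tau>\<^sub>1 \<tau>\<^sub>2 \<tau>\<^sub>3 x y z \<in> A.odd_part"
    unfolding A by (rule A.iota_odd_part[OF \<tau> t])
  show "transfer (double_bracket_in \<iota> P \<tau>\<^sub>1 \<tau>\<^sub>2 \<tau>\<^sub>3 x y z) = double_bracket_in \<iota>' P \<tau>\<^sub>1 \<tau>\<^sub>2 \<tau>\<^sub>3 x y z"
    unfolding A B by (rule transfer_iota[OF \<tau> t])
qed

text \<open>Membership in \<open>A.odd_part\<close> is part of the property because the induction
  over sums applies \<open>transfer_add\<close> to double brackets.\<close>

definition preserves :: "'l \<Rightarrow> 'l \<Rightarrow> 'l \<Rightarrow> bool" where
  "preserves x y z \<longleftrightarrow> A.lbr (A.lbr x y) z \<in> A.odd_part \<and>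
     transfer (A.lbr (A.lbr x y) z) = B.lbr (B.lbr (transfer x) (transfer y)) (transfer z)"

lemma preserves_iota:
  assumes "\<tau>\<^sub>1 \<in> signs" "\<tau>\<^sub>2 \<in> signs" "\<tau>\<^sub>3 \<in> signs"
    and "x \<in> part P \<tau>\<^sub>1" "y \<in> part P \<tau>\<^sub>2" "z \<in> part P \<tau>\<^sub>3"
  shows "preserves (\<iota> \<tau>\<^sub>1 x) (\<iota> \<tau>\<^sub>2 y) (\<iota> \<tau>\<^sub>3 z)"
  unfolding preserves_def transfer_iota[OF assms(1,4)] transfer_iota[OF assms(2,5)]
    transfer_iota[OF assms(3,6)] A.bracket_eq_double_bracket_in[OF assms]
    B.bracket_eq_double_bracket_in[OF assms]
  using transfer_double_bracket_in[OF assms] by simp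

text \<open>Both sides are additive in each argument, so three inductions, in z, then y, then x,
  reduce the claim to homogeneous elements.\<close>

lemma preserves_odd_part:
  assumes "x \<in> A.odd_part" "y \<in> A.odd_part" "z \<in> A.odd_part"
  shows "preserves x y z"
proof -
  note additive = A.lbr_left(1) A.lbr_right(1) B.lbr_left(1) B.lbr_right(1) transfer_add
    A.subspace_add[OF A.subspace_odd_part]
  have 1: "preserves (\<iota> \<tau>\<^sub>1 x') (\<iota> \<tau>\<^sub>2 y') z"
    if "\<tau>\<^sub>1 \<in> signs" "\<tau>\<^sub>2 \<in> signs" "x' \<in> part P \<tau>\<^sub>1" "y' \<in> part P \<tau>\<^sub>2" for \<tau>\<^sub>1 \<tau>\<^sub>2 x' y'
    using assms(3)
  proof (induction rule: A.odd_part_induct)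
    case (hom \<tau> z')
    then show ?case
      using that by (intro preserves_iota)
  next
    case (add a b)
    then show ?case
      unfolding preserves_def by (simp add: additive)
  qed
  have 2: "preserves (\<iota> \<tau>\<^sub>1 x') y z" if "\<tau>\<^sub>1 \<in> signs" "x' \<in> part P \<tau>\<^sub>1" for \<tau>\<^sub>1 x'
    using assms(2)
  proof (induction rule: A.odd_part_induct)
    case (hom \<tau> y')
    then show ?case
      using that by (intro 1)
  next
    case (add a b)
    then show ?case
      unfolding preserves_def by (simp add: additive)
  qed
  show ?thesis
    using assms(1)
  proof (induction rule: A.odd_part_induct)
    case (hom \<tau> x')
    then show ?case
      by (rule 2)
  next
    case (add a b)
    then show ?case
      unfolding preserves_def by (simp add: additive)
  qed
qed

lemma transfer_weyl_isomorphism: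
  assumes u: "u \<in> weyl_group"
  shows "sp_isomorphism (weyl_pair u L) (weyl_pair u L') (\<lambda>_. transfer)"
proof -
  interpret V: bc2_lie "weyl_lie u L"
    by unfold_locales (rule A.bc2_graded_weyl[OF u])
  interpret W: bc2_lie "weyl_lie u L'"
    by unfold_locales (rule B.bc2_graded_weyl[OF u])
  obtain \<pi> \<rho> a b where d: "weyl_data u \<pi> \<rho> a b"
    using weyl_data_exists[OF u] by blast
  \<comment> \<open>Both components are images of the same component of P, under \<iota> and
    \<iota>' respectively, by \<open>pcomp_weyl\<close>.\<close>
  have image_pcomp: "transfer ` pcomp (weyl_pair u L) \<sigma> i = pcomp (weyl_pair u L') \<sigma> i"
    if \<sigma>: "\<sigma> \<in> signs" for \<sigma> i
  proof -
    have s: "\<pi> * \<sigma> \<in> signs" "\<rho> * \<sigma> \<in> signs"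
      using d \<sigma> unfolding weyl_data_def by auto
    have im: "transfer ` (\<iota> \<tau> ` pcomp P \<tau> c) = \<iota>' \<tau> ` pcomp P \<tau> c" if "\<tau> \<in> signs" for \<tau> c
      unfolding image_image
      by (rule image_cong[OF refl]) (simp add: transfer_iota[OF that] A.pcomp_part[OF that])
    have "i = 0 \<or> i = 1 \<or> i \<notin> {0, 1}"
      by auto
    then show ?thesis
    proof (elim disjE)
      assume "i = 0"
      then show ?thesis
        by (simp only: A.pcomp_weyl(1)[OF u d \<sigma>] B.pcomp_weyl(1)[OF u d \<sigma>] im[OF s(1)])
    next
      assume "i = 1"
      then show ?thesis
        by (simp only: A.pcomp_weyl(2)[OF u d \<sigma>] B.pcomp_weyl(2)[OF u d \<sigma>] im[OF s(2)])
    next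
      assume i: "i \<notin> {0, 1}"
      have "transfer 0 = 0"
        using transfer_add[of 0 0] A.subspace_0[OF A.subspace_odd_part] by simp
      then show ?thesis
        using V.lcomp_row_other[OF \<sigma> i] W.lcomp_row_other[OF \<sigma> i]
        by (simp add: weyl_pair_def enveloped_pair_def)
    qed
  qed
  have part_odd: "lrow (weyl_lie u L) \<sigma> \<subseteq> A.odd_part" if "\<sigma> \<in> signs" for \<sigma>
    using V.lrow_subset_odd_part[OF that] A.odd_part_weyl[OF u] by simp
  \<comment> \<open>Surjectivity is checked on the two components of the row, of which the row is
    the sum.\<close>
  have bij: "bij_betw transfer (lrow (weyl_lie u L) \<sigma>) (lrow (weyl_lie u L') \<sigma>)"
    if \<sigma>: "\<sigma> \<in> signs" for \<sigma>
  proof (rule bij_betw_imageI)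
    show "inj_on transfer (lrow (weyl_lie u L) \<sigma>)"
      by (rule inj_on_subset[OF transfer_inj part_odd[OF \<sigma>]])
    let ?C = "\<lambda>\<alpha>. lcomp (weyl_lie u L) \<alpha>" and ?D = "\<lambda>\<alpha>. lcomp (weyl_lie u L') \<alpha>"
    have im: "transfer ` ?C (\<sigma>, 0) = ?D (\<sigma>, 0)" "transfer ` ?C (\<sigma>, \<sigma>) = ?D (\<sigma>, \<sigma>)"
      using image_pcomp[OF \<sigma>, of 0] image_pcomp[OF \<sigma>, of 1]
      by (simp_all add: weyl_pair_def enveloped_pair_def)
    have sub: "?C (\<sigma>, j) \<subseteq> A.odd_part" for j
      using V.lcomp_subset_lrow part_odd[OF \<sigma>] by (rule subset_trans)
    have "transfer ` lrow (weyl_lie u L) \<sigma>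
        = {transfer (x + y) | x y. x \<in> ?C (\<sigma>, 0) \<and> y \<in> ?C (\<sigma>, \<sigma>)}"
      unfolding V.lrow_eq[OF \<sigma>] by auto
    also have "\<dots> = {transfer x + transfer y | x y. x \<in> ?C (\<sigma>, 0) \<and> y \<in> ?C (\<sigma>, \<sigma>)}"
      using transfer_add sub by (metis (no_types, opaque_lifting) subsetD)
    also have "\<dots> = {x + y | x y. x \<in> transfer ` ?C (\<sigma>, 0) \<and> y \<in> transfer ` ?C (\<sigma>, \<sigma>)}"
      by auto
    also have "\<dots> = lrow (weyl_lie u L') \<sigma>"
      unfolding im W.lrow_eq[OF \<sigma>] ..
    finally show "transfer ` lrow (weyl_lie u L) \<sigma> = lrow (weyl_lie u L') \<sigma>" .
  qed
  \<comment> \<open>The sign \<sigma> refers to the new grading. With respect to P the three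
    elements may have mixed signs, so the full strength of \<open>preserves_odd_part\<close> is
    required.\<close>
  have product: "transfer (A.lbr (A.lbr x y) z)
      = B.lbr (B.lbr (transfer x) (transfer y)) (transfer z)"
    if "\<sigma> \<in> signs" "x \<in> lrow (weyl_lie u L) \<sigma>" "y \<in> lrow (weyl_lie u L) (-\<sigma>)"
      "z \<in> lrow (weyl_lie u L) \<sigma>" for \<sigma> x y z
  proof -
    have "-\<sigma> \<in> signs"
      using that(1) by auto
    then show ?thesis
      using preserves_odd_part that part_odd unfolding preserves_def by (meson subsetD)
  qed
  show ?thesis
    unfolding sp_isomorphism_def
  proof (intro ballI conjI allI)
    fix \<sigma> :: int
    assume \<sigma>: "\<sigma> \<in> signs"
    note odd = subsetD[OF part_odd[OF \<sigma>]]
    show "bij_betw transfer (part (weyl_pair u L) \<sigma>) (part (weyl_pair u L') \<sigma>)"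
      unfolding weyl_pair_fields by (rule bij[OF \<sigma>])
    show "transfer (x + y) = transfer x + transfer y"
      if "x \<in> part (weyl_pair u L) \<sigma>" "y \<in> part (weyl_pair u L) \<sigma>" for x y
      using that unfolding weyl_pair_fields by (intro transfer_add odd)
    show "transfer (scal (weyl_pair u L) c x) = scal (weyl_pair u L') c (transfer x)"
      if "x \<in> part (weyl_pair u L) \<sigma>" for c x
      using that unfolding weyl_pair_fields by (intro transfer_scale odd)
    show "transfer (tprod (weyl_pair u L) \<sigma> x y z)
        = tprod (weyl_pair u L') \<sigma> (transfer x) (transfer y) (transfer z)"
      if "x \<in> part (weyl_pair u L) \<sigma>" "y \<in> part (weyl_pair u L) (-\<sigma>)" "z \<in> part (weyl_pair u L) \<sigma>"
      for x y z
      using that unfolding weyl_pair_fields by (rule product[OF \<sigma>])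
    show "transfer ` pcomp (weyl_pair u L) \<sigma> i = pcomp (weyl_pair u L') \<sigma> i" for i
      by (rule image_pcomp[OF \<sigma>])
  qed
qed

end

text \<open>The second clause says that \<phi> is the identity once both Weyl images are described
  by elements of P. Since their parts are sums of such elements, it determines \<phi> on
  them.\<close>

lemma (in enveloping) weyl_pair_independent:
  fixes L' :: "('k, 'm::ab_group_add) graded_lie"
  assumes "u \<in> weyl_group" "envelops L' \<iota>' P"
  shows "\<exists>\<phi>. sp_isomorphism (weyl_pair u L) (weyl_pair u L') \<phi> \<and>
    (\<forall>\<sigma>\<in>signs. \<forall>\<tau>\<in>signs. \<forall>x\<in>part P \<tau>.
       \<iota> \<tau> x \<in> part (weyl_pair u L) \<sigma> \<longrightarrow> \<phi> \<sigma> (\<iota> \<tau> x) = \<iota>' \<tau> x)"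
proof -
  interpret two_envelopes L \<iota> L' \<iota>' P
    using env assms(2) by unfold_locales
  show ?thesis
    using transfer_weyl_isomorphism[OF assms(1)] transfer_iota
    by (intro exI[of _ "\<lambda>_. transfer"]) simp
qed

text \<open>The signs come from \<open>pcomp_weyl\<close>: index i and sign \<sigma> in the Weyl
  image mean sign t i * \<sigma> and index c i in P. The middle factor has sign -\<sigma>, hence - t
  j * \<sigma>.\<close>

lemma (in enveloping) weyl_product:
  assumes "weyl_data u \<pi> \<rho> a b"
  shows "let t = (\<lambda>i::int. if i = 0 then \<pi> else \<rho>); c = (\<lambda>i::int. if i = 0 then a else b) in
    \<forall>\<sigma>\<in>signs. \<forall>i\<in>{0, 1}. \<forall>j\<in>{0, 1}. \<forall>k\<in>{0, 1}.
    \<forall>x\<in>pcomp P (t i * \<sigma>) (c i). \<forall>y\<in>pcomp P (- t j * \<sigma>) (c j). \<forall>z\<in>pcomp P (t k * \<sigma>) (c k).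
      tprod (weyl_pair u L) \<sigma> (\<iota> (t i * \<sigma>) x) (\<iota> (- t j * \<sigma>) y) (\<iota> (t k * \<sigma>) z)
      = double_bracket_in \<iota> P (t i * \<sigma>) (- t j * \<sigma>) (t k * \<sigma>) x y z"
  unfolding Let_def
proof (intro ballI)
  fix \<sigma> i j k :: int and x y z
  let ?t = "\<lambda>i::int. if i = 0 then \<pi> else \<rho>" and ?c = "\<lambda>i::int. if i = 0 then a else b"
  assume \<sigma>: "\<sigma> \<in> signs" and x: "x \<in> pcomp P (?t i * \<sigma>) (?c i)"
    and y: "y \<in> pcomp P (- ?t j * \<sigma>) (?c j)" and z: "z \<in> pcomp P (?t k * \<sigma>) (?c k)"
  have s: "?t l * \<sigma> \<in> signs" "- ?t l * \<sigma> \<in> signs" for l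
    using \<sigma> assms unfolding weyl_data_def by auto
  have "lbr (lbr (\<iota> (?t i * \<sigma>) x) (\<iota> (- ?t j * \<sigma>) y)) (\<iota> (?t k * \<sigma>) z)
      = double_bracket_in \<iota> P (?t i * \<sigma>) (- ?t j * \<sigma>) (?t k * \<sigma>) x y z"
    by (intro bracket_eq_double_bracket_in s pcomp_part[OF s(1) x] pcomp_part[OF s(2) y]
        pcomp_part[OF s(1) z])
  then show "tprod (weyl_pair u L) \<sigma> (\<iota> (?t i * \<sigma>) x) (\<iota> (- ?t j * \<sigma>) y) (\<iota> (?t k * \<sigma>) z)
      = double_bracket_in \<iota> P (?t i * \<sigma>) (- ?t j * \<sigma>) (?t k * \<sigma>) x y z"
    unfolding weyl_pair_fields .
qed

theorem proposition5p1p2: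
  fixes P :: "('k::comm_ring_1, 'p::ab_group_add) sp_pair"
    and L :: "('k, 'l::ab_group_add) graded_lie"
    and \<iota> :: "int \<Rightarrow> 'p \<Rightarrow> 'l"
    and u :: "lattice \<Rightarrow> lattice"
  assumes sixth: "(6::'k) dvd 1"
    and P: "sp_graded_kantor_pair P"
    and u: "u \<in> weyl_group"
    and L: "envelops L \<iota> P"
  shows
    "(envelops (weyl_lie u L) (\<lambda>_ x. x) (weyl_pair u L)) \<and>
     (T_sub (\<lambda>_ x. x) (weyl_pair u L) = T_sub \<iota> P) \<and>
     (tightly_envelops L \<iota> P \<longrightarrow> tightly_envelops (weyl_lie u L) (\<lambda>_ x. x) (weyl_pair u L)) \<and>
     (\<exists>\<pi> \<rho> a b. weyl_data u \<pi> \<rho> a b) \<and>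
     (\<forall>\<pi> \<rho> a b. weyl_data u \<pi> \<rho> a b \<longrightarrow>
        (\<forall>\<sigma>\<in>signs. pcomp (weyl_pair u L) \<sigma> 0 = \<iota> (\<pi> * \<sigma>) ` pcomp P (\<pi> * \<sigma>) a \<and>
                   pcomp (weyl_pair u L) \<sigma> 1 = \<iota> (\<rho> * \<sigma>) ` pcomp P (\<rho> * \<sigma>) b)) \<and>
     (\<forall>\<sigma>\<in>signs. \<forall>i\<in>{0, 1}. \<forall>j\<in>{0, 1}. \<forall>k\<in>{0, 1}.
        \<forall>x\<in>pcomp (weyl_pair u L) \<sigma> i. \<forall>y\<in>pcomp (weyl_pair u L) (-\<sigma>) j.
        \<forall>z\<in>pcomp (weyl_pair u L) \<sigma> k.
          tprod (weyl_pair u L) \<sigma> x y z = bracket L (bracket L x y) z) \<and>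
     (\<forall>\<sigma>\<in>signs. \<forall>x\<in>part P \<sigma>. \<forall>y\<in>part P \<sigma>. \<forall>z\<in>part P \<sigma>.
        bracket L (bracket L (\<iota> \<sigma> x) (\<iota> \<sigma> y)) (\<iota> \<sigma> z) = 0) \<and>
     (\<forall>\<sigma>\<in>signs. \<forall>x\<in>part P \<sigma>. \<forall>y\<in>part P (-\<sigma>). \<forall>z\<in>part P \<sigma>.
        bracket L (bracket L (\<iota> \<sigma> x) (\<iota> (-\<sigma>) y)) (\<iota> \<sigma> z) = \<iota> \<sigma> (tprod P \<sigma> x y z)) \<and>
     (\<forall>\<sigma>\<in>signs. \<forall>x\<in>part P (-\<sigma>). \<forall>y\<in>part P \<sigma>. \<forall>z\<in>part P \<sigma>.
        bracket L (bracket L (\<iota> (-\<sigma>) x) (\<iota> \<sigma> y)) (\<iota> \<sigma> z) = - \<iota> \<sigma> (tprod P \<sigma> y x z)) \<and>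
     (\<forall>\<sigma>\<in>signs. \<forall>x\<in>part P \<sigma>. \<forall>y\<in>part P \<sigma>. \<forall>z\<in>part P (-\<sigma>).
        bracket L (bracket L (\<iota> \<sigma> x) (\<iota> \<sigma> y)) (\<iota> (-\<sigma>) z) = \<iota> \<sigma> (Kop P \<sigma> x y z)) \<and>
     (\<forall>\<pi> \<rho> a b. weyl_data u \<pi> \<rho> a b \<longrightarrow>
        (let t = (\<lambda>i::int. if i = 0 then \<pi> else \<rho>); c = (\<lambda>i::int. if i = 0 then a else b) in
         \<forall>\<sigma>\<in>signs. \<forall>i\<in>{0, 1}. \<forall>j\<in>{0, 1}. \<forall>k\<in>{0, 1}.
         \<forall>x\<in>pcomp P (t i * \<sigma>) (c i). \<forall>y\<in>pcomp P (- t j * \<sigma>) (c j). \<forall>z\<in>pcomp P (t k * \<sigma>) (c k).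
           tprod (weyl_pair u L) \<sigma> (\<iota> (t i * \<sigma>) x) (\<iota> (- t j * \<sigma>) y) (\<iota> (t k * \<sigma>) z)
           = double_bracket_in \<iota> P (t i * \<sigma>) (- t j * \<sigma>) (t k * \<sigma>) x y z)) \<and>
     (\<forall>(L' :: ('k, 'm::ab_group_add) graded_lie) \<iota>'. envelops L' \<iota>' P \<longrightarrow>
        (\<exists>\<phi>. sp_isomorphism (weyl_pair u L) (weyl_pair u L') \<phi> \<and>
             (\<forall>\<sigma>\<in>signs. \<forall>\<tau>\<in>signs. \<forall>x\<in>part P \<tau>.
                \<iota> \<tau> x \<in> part (weyl_pair u L) \<sigma> \<longrightarrow> \<phi> \<sigma> (\<iota> \<tau> x) = \<iota>' \<tau> x)))"
proof -
  interpret enveloping L \<iota> P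
    by unfold_locales (rule L)
  show ?thesis
  proof (intro conjI)
    show "envelops (weyl_lie u L) (\<lambda>_ x. x) (weyl_pair u L)"
      by (rule envelops_weyl[OF u])
    show "T_sub (\<lambda>_ x. x) (weyl_pair u L) = T_sub \<iota> P"
      by (rule T_sub_weyl[OF u])
    show "tightly_envelops L \<iota> P \<longrightarrow> tightly_envelops (weyl_lie u L) (\<lambda>_ x. x) (weyl_pair u L)"
      using tightly_envelops_weyl[OF u] by (rule impI)
    show "\<exists>\<pi> \<rho> a b. weyl_data u \<pi> \<rho> a b"
      by (rule weyl_data_exists[OF u])
  qed (intro allI impI ballI conjI pcomp_weyl[OF u] weyl_pair_fields(3) bracket_same
      iota_tprod[symmetric] bracket_opposite bracket_Kop weyl_product
      weyl_pair_independent[OF u]; assumption)+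
qed

end
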